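(* Let $n\ge4$ be even, $p\ge n+1$ an integer, $c_1$ a positive integer, $a_k=pc_k$, $c_{k+1}=p^2c_k$, and let $T$, $I^{(k)}_i$, $b_{k,i}$ and the measures $\lambda_j$ be as in the context. Then for any distinct $i,j\in\{3,5,\dots,n-1,n\}$, $$\liminf_{k\to\infty}\log_{\lambda_j(I_i^{(k)})}\bigl(\lambda_i(I_i^{(k)})\bigr)\ \le\ \dim_H(\lambda_i,d_{\lambda_j})\ \le\ \liminf_{k\to\infty}\log_{\lambda_j(I_i^{(k)})} b_{k,i}^{-1}.$$
   Context: $\pi$ is the permutation of $\{1,\dots,n\}$ with top row $1,2,\dots,n$ and bottom row $n,3,2,5,4,\dots,n-1,n-2,1$. Right Rauzy induction: step "0" when the rightmost domain (top) interval is longer, "1" when the rightmost image (bottom) interval is longer; induce on the interval with the shorter length removed from the right. For $a,c>0$, $\dot\gamma_{m,a}=1^{n-1-m}0^a10^2$, $\gamma_{a,c}=0\,\dot\gamma_{n-2,a}\cdots\dot\gamma_{2,a}\,1^{c(n-1)}$; its transition matrix $\Theta_{a,c}$ (old lengths $=\Theta_{a,c}\cdot$new lengths) has row $1=(1,c,\dots,c)$, row $n=(1,c+1,\dots,c+1)$, and for $1\le i\le(n-2)/2$: row $2i$ has $0$ in column 1, $2$ in columns $2i,2i+1$, $1$ in the other columns among $2,\dots,n$; row $2i+1$ has $a$ in column $2i$, $a+1$ in column $2i+1$, $0$ elsewhere. $\Theta_k=\Theta_{a_k,c_k}$. $T$ is an IET of $[0,1)$ with permutation $\pi$ whose right Rauzy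 induction path is $\gamma_{a_1,c_1}\gamma_{a_2,c_2}\cdots$. For $k\ge0$, $I^{(k)}$ is the interval (with left endpoint $0$) on which the induced (first return) map of $T$ lives after the first $k$ blocks $\gamma_{a_1,c_1}\cdots\gamma_{a_k,c_k}$, and $I^{(k)}_1,\dots,I^{(k)}_n$ are its exchanged subintervals ($I^{(0)}=[0,1)$, $I^{(0)}_i=X_i$ the initial subintervals); length vectors satisfy $\ell^{(k-1)}=\Theta_k\ell^{(k)}$. $b_{k,i}=|\Theta_1\cdots\Theta_ke_i|$, the sum of entries, which is the first return time of $I^{(k)}_i$ to $I^{(k)}$. For $v\ge0$, $\overline v=v/|v|$. For $j\in\{1,\dots,n\}$, $\lambda_j$ denotes the $T$-invariant Borel probability measure on $[0,1)$ such that for every $k\ge0$ the vector $(\lambda_j(I^{(k)}_1),\dots,\lambda_j(I^{(k)}_n))$ is a positive multiple of $\lim_{m\to\infty}\overline{\Theta_{k+1}\cdots\Theta_me_j}$ (these limits exist). For a non-atomic probability measure $\nu$ on $[0,1)$, $d_\nu(x,y)=\nu([\min(x,y),\max(x,y)))$; for a measure $\mu$, $\dim_H(\mu,d)$ is the infimum of the Hausdorff dimensions, with respect to $d$, of Borel sets $A$ with $\mu(A)=1$. *)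

theory Defs
  imports "HOL-Probability.Probability"
begin

text \<open>A labelled IET is given by the top row (letters in domain order),
the bottom row (letters in image order) and a length function on letters.\<close>

type_synonym rstate = "nat list \<times> nat list \<times> (nat \<Rightarrow> real)"

definition top_row :: "nat \<Rightarrow> nat list" where
  "top_row n = [1..<n+1]"

definition bot_row :: "nat \<Rightarrow> nat list" where
  "bot_row n = [n] @ concat (map (\<lambda>i. [2*i+1, 2*i]) [1..<(n-2) div 2 + 1]) @ [1]"

definition left_end :: "nat list \<Rightarrow> (nat \<Rightarrow> real) \<Rightarrow> nat \<Rightarrow> real" where
  "left_end xs l x = sum_list (map l (takeWhile (\<lambda>y. y \<noteq> x) xs))"

definition iet_map :: "nat list \<Rightarrow> nat list \<Rightarrow> (nat \<Rightarrow> real) \<Rightarrow> real \<Rightarrow> real" where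
  "iet_map t b l x =
     (if \<exists>\<alpha>\<in>set t. left_end t l \<alpha> \<le> x \<and> x < left_end t l \<alpha> + l \<alpha>
      then (let \<alpha> = (SOME \<alpha>. \<alpha> \<in> set t \<and> left_end t l \<alpha> \<le> x \<and> x < left_end t l \<alpha> + l \<alpha>)
            in x - left_end t l \<alpha> + left_end b l \<alpha>)
      else x)"

text \<open>Remove the last letter (which is y) and reinsert it right after x.\<close>
definition move_after :: "nat list \<Rightarrow> nat \<Rightarrow> nat \<Rightarrow> nat list" where
  "move_after xs x y =
     (let ys = butlast xs in takeWhile (\<lambda>z. z \<noteq> x) ys @ [x, y] @ tl (dropWhile (\<lambda>z. z \<noteq> x) ys))"

definition rauzy_type :: "rstate \<Rightarrow> nat option" where
  "rauzy_type s = (case s of (t, b, l) \<Rightarrow>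
     if l (last t) > l (last b) then Some 0
     else if l (last b) > l (last t) then Some 1 else None)"

definition rauzy_step :: "rstate \<Rightarrow> rstate" where
  "rauzy_step s = (case s of (t, b, l) \<Rightarrow>
     (let \<alpha> = last t; \<beta> = last b in
      if l \<alpha> > l \<beta> then (t, move_after b \<alpha> \<beta>, l(\<alpha> := l \<alpha> - l \<beta>))
      else (move_after t \<beta> \<alpha>, b, l(\<beta> := l \<beta> - l \<alpha>))))"

definition rauzy_iter :: "nat \<Rightarrow> (nat \<Rightarrow> real) \<Rightarrow> nat \<Rightarrow> rstate" where
  "rauzy_iter n l m = (rauzy_step ^^ m) (top_row n, bot_row n, l)"

definition gdot :: "nat \<Rightarrow> nat \<Rightarrow> nat \<Rightarrow> nat list" where
  "gdot n m a = replicate (n - 1 - m) 1 @ replicate a 0 @ [1, 0, 0]"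

definition gamma :: "nat \<Rightarrow> nat \<Rightarrow> nat \<Rightarrow> nat list" where
  "gamma n a c = [0] @ concat (map (\<lambda>i. gdot n (n - 2*i) a) [1..<(n-2) div 2 + 1])
                 @ replicate (c * (n - 1)) 1"

definition block_start :: "nat \<Rightarrow> (nat \<Rightarrow> nat) \<Rightarrow> (nat \<Rightarrow> nat) \<Rightarrow> nat \<Rightarrow> nat" where
  "block_start n a c k = (\<Sum>q=1..k. length (gamma n (a q) (c q)))"

definition has_rauzy_path :: "nat \<Rightarrow> (nat \<Rightarrow> nat) \<Rightarrow> (nat \<Rightarrow> nat) \<Rightarrow> (nat \<Rightarrow> real) \<Rightarrow> bool" where
  "has_rauzy_path n a c l =
     (\<forall>k r. r < length (gamma n (a (Suc k)) (c (Suc k))) \<longrightarrow>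
        rauzy_type (rauzy_iter n l (block_start n a c k + r)) = Some (gamma n (a (Suc k)) (c (Suc k)) ! r))"

definition Ik :: "nat \<Rightarrow> (nat \<Rightarrow> nat) \<Rightarrow> (nat \<Rightarrow> nat) \<Rightarrow> (nat \<Rightarrow> real) \<Rightarrow> nat \<Rightarrow> nat \<Rightarrow> real set" where
  "Ik n a c l k i = (case rauzy_iter n l (block_start n a c k) of (t, b, l') \<Rightarrow>
      {left_end t l' i ..< left_end t l' i + l' i})"

text \<open>Matrices indexed by {1..n} x {1..n}.\<close>
definition Theta :: "nat \<Rightarrow> nat \<Rightarrow> nat \<Rightarrow> nat \<Rightarrow> nat \<Rightarrow> real" where
  "Theta n a c r s =
     (if r = 1 then (if s = 1 then 1 else real c)
      else if r = n then (if s = 1 then 1 else real c + 1)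
      else if even r then (if s = 1 then 0 else if s = r \<or> s = r + 1 then 2 else 1)
      else (if s = r - 1 then real a else if s = r then real a + 1 else 0))"

definition mat_mult :: "nat \<Rightarrow> (nat \<Rightarrow> nat \<Rightarrow> real) \<Rightarrow> (nat \<Rightarrow> nat \<Rightarrow> real) \<Rightarrow> nat \<Rightarrow> nat \<Rightarrow> real" where
  "mat_mult n A B r s = (\<Sum>q=1..n. A r q * B q s)"

definition mat_id :: "nat \<Rightarrow> nat \<Rightarrow> real" where
  "mat_id r s = (if r = s then 1 else 0)"

fun theta_prod :: "nat \<Rightarrow> (nat \<Rightarrow> nat) \<Rightarrow> (nat \<Rightarrow> nat) \<Rightarrow> nat \<Rightarrow> nat \<Rightarrow> nat \<Rightarrow> nat \<Rightarrow> real" where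
  "theta_prod n a c k 0 = mat_id"
| "theta_prod n a c k (Suc m) =
     (if Suc m \<le> k then mat_id
      else mat_mult n (theta_prod n a c k m) (Theta n (a (Suc m)) (c (Suc m))))"

definition bki :: "nat \<Rightarrow> (nat \<Rightarrow> nat) \<Rightarrow> (nat \<Rightarrow> nat) \<Rightarrow> nat \<Rightarrow> nat \<Rightarrow> real" where
  "bki n a c k i = (\<Sum>r=1..n. theta_prod n a c 0 k r i)"

definition is_lambda :: "nat \<Rightarrow> (nat \<Rightarrow> nat) \<Rightarrow> (nat \<Rightarrow> nat) \<Rightarrow> (nat \<Rightarrow> real) \<Rightarrow> nat \<Rightarrow> real measure \<Rightarrow> bool" where
  "is_lambda n a c l j M \<longleftrightarrow>
     sets M = sets borel \<and> prob_space M \<and> emeasure M {0..<1} = 1 \<and>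
     distr M borel (iet_map (top_row n) (bot_row n) l) = M \<and>
     (\<forall>k. \<exists>u. (\<forall>r\<in>{1..n}. (\<lambda>m. theta_prod n a c k m r j / (\<Sum>q=1..n. theta_prod n a c k m q j))
                                \<longlonglongrightarrow> u r) \<and>
              (\<exists>t>0. \<forall>r\<in>{1..n}. measure M (Ik n a c l k r) = t * u r))"

definition pdiam :: "('a \<Rightarrow> 'a \<Rightarrow> real) \<Rightarrow> 'a set \<Rightarrow> real" where
  "pdiam d U = (if U = {} then 0 else Sup {d x y | x y. x \<in> U \<and> y \<in> U})"

definition hterm :: "real \<Rightarrow> ('a \<Rightarrow> 'a \<Rightarrow> real) \<Rightarrow> 'a set \<Rightarrow> ennreal" where
  "hterm s d U = (if U = {} then 0 else if s = 0 then 1 else ennreal (pdiam d U powr s))"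

definition hcontent :: "real \<Rightarrow> real \<Rightarrow> ('a \<Rightarrow> 'a \<Rightarrow> real) \<Rightarrow> 'a set \<Rightarrow> ennreal" where
  "hcontent s \<delta> d A =
     (INF U \<in> {U :: nat \<Rightarrow> 'a set. A \<subseteq> (\<Union>i. U i) \<and> (\<forall>i. \<forall>x\<in>U i. \<forall>y\<in>U i. d x y \<le> \<delta>)}.
        (\<Sum>i. hterm s d (U i)))"

definition hmeasure :: "real \<Rightarrow> ('a \<Rightarrow> 'a \<Rightarrow> real) \<Rightarrow> 'a set \<Rightarrow> ennreal" where
  "hmeasure s d A = (SUP \<delta> \<in> {0<..}. hcontent s \<delta> d A)"

definition hdim :: "('a \<Rightarrow> 'a \<Rightarrow> real) \<Rightarrow> 'a set \<Rightarrow> ereal" where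
  "hdim d A = Inf {ereal s | s. s \<ge> 0 \<and> hmeasure s d A = 0}"

definition dimH_measure :: "real measure \<Rightarrow> (real \<Rightarrow> real \<Rightarrow> real) \<Rightarrow> ereal" where
  "dimH_measure \<mu> d = Inf {hdim d A | A. A \<in> sets borel \<and> A \<subseteq> {0..<1} \<and> emeasure \<mu> A = 1}"

definition d_nu :: "real measure \<Rightarrow> real \<Rightarrow> real \<Rightarrow> real" where
  "d_nu \<nu> x y = measure \<nu> {min x y ..< max x y}"

definition special_idx :: "nat \<Rightarrow> nat set" where
  "special_idx n = {m. 3 \<le> m \<and> m \<le> n - 1 \<and> odd m} \<union> {n}"

end

theory Submission
  imports Defs "HOL-Real_Asymp.Real_Asymp"
begin

text \<open>
  Since \<open>a k\<close> and \<open>c k\<close> both grow like \<open>p ^ (2 * k)\<close> up to bounded factors, every transition matrix is so moderate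
  that for every \<open>T\<close>-invariant probability measure all the intervals of level \<open>k\<close> have measure \<open>p ^ (- k\<^sup>2 + O(k))\<close>, and
  likewise \<open>bki n a c k i\<close> is at least \<open>p ^ (k\<^sup>2 - k)\<close>. Hence the left lower limit is at most 1 and the right one
  at least 1. The dimension equals 1: it is at most 1 because \<open>d_nu \<nu>\<close> is pulled back from the line by the distribution
  function of \<open>\<nu>\<close>. Conversely, an interval containing no floor of the level \<open>k\<close> Rauzy towers is covered by two of
  them, and as the logarithms of consecutive scales are asymptotically equal, \<open>\<mu> J \<le> C * \<nu> J powr s\<close> for every interval
  \<open>J\<close> and every \<open>s < 1\<close>; the mass distribution principle applies. Of the measures only their invariance is used.
\<close>

text \<open>The obstacle is that the lengths decide which Rauzy step is taken, while the estimates
  concern other measures. The measures of the exchanged intervals are therefore sent through the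
  same row moves as the lengths: as the exchange translates each interval, invariance can be stated
  between intervals only, and a step subtracts measures exactly where it subtracts lengths. Running
  the word \<open>gamma\<close> symbolically then yields the linear recursion with the rows of
  \<open>Theta\<close> for each measure.

  The quadratic exponents are sums over blocks. A block costs the total mass at most a factor
  \<open>K * p ^ (2 * k + 1)\<close>, and these exponents add up to k^2; the interval labelled
  \<open>n\<close> shrinks at least by \<open>p ^ (2 * k)\<close>, and those add up to k^2 - k. One
  block matrix has zero entries, but after three blocks every interval dominates a later total mass;
  hence the shift k + 3 in \<open>lo\<close>.

  Both measures are carried along together, since comparing them on an interval requires common
  floors.\<close>

section \<open>Left endpoints and row moves\<close>

lemma left_end_append:
  "x \<notin> set xs \<Longrightarrow> left_end (xs @ x # ys) l x = sum_list (map l xs)"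
  unfolding left_end_def by (subst takeWhile_append2) auto

lemma left_end_disjoint:
  assumes "distinct t" "x \<in> set t" "y \<in> set t" "x \<noteq> y" "\<forall>z\<in>set t. 0 < l z"
  shows "left_end t l x + l x \<le> left_end t l y \<or> left_end t l y + l y \<le> left_end t l x"
proof -
  have *: "left_end t l x + l x \<le> left_end t l y"
    if t: "t = xs @ x # ys @ y # zs" and d: "distinct t" and pos: "\<forall>z\<in>set t. 0 < l z" for x y xs ys zs
  proof -
    have "left_end t l x = sum_list (map l xs)"
      using d unfolding t by (intro left_end_append) auto
    moreover have "left_end t l y = sum_list (map l (xs @ x # ys))"
      using d left_end_append[of y "xs @ x # ys" zs l] unfolding t by auto
    moreover have "0 \<le> sum_list (map l ys)"
      using pos unfolding t by (intro sum_list_nonneg) (auto intro: less_imp_le)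
    ultimately show ?thesis by simp
  qed
  obtain xs ys where t: "t = xs @ x # ys" "x \<notin> set xs"
    using assms(2) by (meson split_list_first)
  consider "y \<in> set xs" | "y \<in> set ys" using assms t by auto
  then show ?thesis
  proof cases
    case 1
    then obtain us vs where "xs = us @ y # vs" by (meson split_list)
    then show ?thesis using *[of us y vs x ys] t assms by auto
  next
    case 2
    then obtain us vs where "ys = us @ y # vs" by (meson split_list)
    then show ?thesis using *[of xs x us y vs] t assms by auto
  qed
qed

lemma left_end_bounds:
  assumes "distinct t" "x \<in> set t" "\<forall>z\<in>set t. 0 < l z"
  shows "0 \<le> left_end t l x" "left_end t l x + l x \<le> sum l (set t)"
proof -
  obtain xs ys where t: "t = xs @ x # ys" "x \<notin> set xs"
    using assms(2) by (meson split_list_first)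
  have e: "left_end t l x = sum_list (map l xs)"
    unfolding t(1) by (rule left_end_append[OF t(2)])
  show "0 \<le> left_end t l x"
    unfolding e using assms(3) t(1) by (intro sum_list_nonneg) (auto intro: less_imp_le)
  have "0 \<le> sum_list (map l ys)"
    using assms(3) t(1) by (intro sum_list_nonneg) (auto intro: less_imp_le)
  moreover have "sum l (set t) = sum_list (map l t)"
    using assms(1) by (simp add: sum_list_distinct_conv_sum_set)
  ultimately show "left_end t l x + l x \<le> sum l (set t)"
    using e unfolding t(1) by simp
qed

lemma left_end_last:
  assumes "distinct t" "t \<noteq> []"
  shows "left_end t l (last t) + l (last t) = sum l (set t)"
proof -
  obtain xs x where t: "t = xs @ [x]" using assms(2) by (meson rev_exhaust)
  have "left_end t l x = sum_list (map l xs)"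
    using assms left_end_append[of x xs "[]" l] unfolding t by simp
  moreover have "sum l (set t) = sum_list (map l t)"
    using assms(1) by (simp add: sum_list_distinct_conv_sum_set)
  ultimately show ?thesis unfolding t by simp
qed

lemma left_end_cover:
  assumes "distinct t" "0 \<le> z" "z < sum l (set t)"
  shows "\<exists>x\<in>set t. left_end t l x \<le> z \<and> z < left_end t l x + l x"
proof -
  have "z < sum_list (map l t)"
    using assms by (simp add: sum_list_distinct_conv_sum_set)
  with assms(1) show ?thesis
  proof (induction t rule: rev_induct)
    case Nil
    then show ?case using assms(2) by simp
  next
    case (snoc x xs)
    show ?case
    proof (cases "z < sum_list (map l xs)")
      case True
      then obtain y where y: "y \<in> set xs" "left_end xs l y \<le> z" "z < left_end xs l y + l y"
        using snoc by auto
      have "left_end (xs @ [x]) l y = left_end xs l y"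
        using y(1) unfolding left_end_def by (subst takeWhile_append1) auto
      then show ?thesis using y by (intro bexI[of _ y]) auto
    next
      case False
      then have "left_end (xs @ [x]) l x = sum_list (map l xs)"
        using snoc.prems left_end_append[of x xs "[]" l] by simp
      then show ?thesis using False snoc.prems by auto
    qed
  qed
qed

section \<open>Reinsertion of the losing letter\<close>

lemma move_after_eq:
  assumes "x \<notin> set xs"
  shows "move_after (xs @ x # ys @ [y]) x y = xs @ x # y # ys"
proof -
  have "takeWhile (\<lambda>z. z \<noteq> x) (xs @ x # ys) = xs" "dropWhile (\<lambda>z. z \<noteq> x) (xs @ x # ys) = x # ys"
    using assms by (induction xs) auto
  then show ?thesis by (simp add: move_after_def butlast_append)
qed

lemma split_winner:
  assumes "distinct t" "x \<in> set t" "t \<noteq> []" "x \<noteq> last t"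
  obtains xs ys where "t = xs @ x # ys @ [last t]" "x \<notin> set xs"
proof -
  obtain xs ys where t: "t = xs @ x # ys" "x \<notin> set xs"
    using assms(2) by (meson split_list_first)
  with assms have "ys \<noteq> []" by auto
  then obtain zs z where "ys = zs @ [z]" by (meson rev_exhaust)
  then show ?thesis using that t by simp
qed

lemma distinct_move_after:
  assumes "distinct t" "x \<in> set t" "t \<noteq> []" "x \<noteq> last t"
  shows "distinct (move_after t x (last t))" "set (move_after t x (last t)) = set t"
proof -
  obtain xs ys where t: "t = xs @ x # ys @ [last t]" "x \<notin> set xs"
    using split_winner[OF assms] by metis
  have m: "move_after t x (last t) = xs @ x # last t # ys"
    by (subst (1) t(1)) (rule move_after_eq[OF t(2)])
  have "distinct (xs @ x # ys @ [last t])" using assms(1) t(1) by simp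
  then show "distinct (move_after t x (last t))" unfolding m by auto
  have "set t = set (xs @ x # ys @ [last t])" using t(1) by simp
  then show "set (move_after t x (last t)) = set t" unfolding m by auto
qed

text \<open>The shortened winner \<open>x\<close> followed by the loser fills exactly the old place
  of \<open>x\<close>. So no other left end moves, and the loser now starts where the cut was
  made.\<close>

lemma left_end_move_after:
  assumes "distinct t" "x \<in> set t" "t \<noteq> []" "x \<noteq> last t" "z \<in> set t"
  shows "left_end (move_after t x (last t)) (l(x := l x - l (last t))) z =
    (if z = last t then left_end t l x + l x - l (last t) else left_end t l z)"
proof -
  obtain xs ys where t: "t = xs @ x # ys @ [last t]" "x \<notin> set xs"
    using split_winner[OF assms(1-4)] by metis
  define y where "y = last t"
  have ty: "t = xs @ x # ys @ [y]" using t(1) y_def by simp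
  have d: "distinct (xs @ x # ys @ [y])" using assms(1) ty by simp
  have m: "move_after t x y = xs @ x # y # ys"
    by (subst ty) (rule move_after_eq[OF t(2)])
  define l' where "l' = l(x := l x - l y)"
  have same: "sum_list (map l' us) = sum_list (map l us)" if "x \<notin> set us" for us
    using that by (intro arg_cong[where f = sum_list] map_cong) (auto simp: l'_def)
  have lx: "left_end t l x = sum_list (map l xs)"
    unfolding ty using t(2) by (rule left_end_append)
  consider "z \<in> set xs" | "z = x" | "z = y" | "z \<in> set ys"
    using assms(5) ty by auto
  then have "left_end (move_after t x y) l' z =
    (if z = y then left_end t l x + l x - l y else left_end t l z)"
  proof cases
    case 1
    then obtain us vs where xs: "xs = us @ z # vs" by (meson split_list)
    have "left_end (us @ z # vs @ x # y # ys) l' z = sum_list (map l' us)"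
      using d xs by (intro left_end_append) auto
    moreover have "left_end (us @ z # vs @ x # ys @ [y]) l z = sum_list (map l us)"
      using d xs by (intro left_end_append) auto
    moreover have "z \<noteq> y" using 1 d by auto
    ultimately show ?thesis using same[of us] d unfolding m unfolding ty xs by auto
  next
    case 2
    have "left_end (xs @ x # y # ys) l' x = sum_list (map l' xs)"
      using t(2) by (rule left_end_append)
    moreover have "x \<noteq> y" using d by auto
    ultimately show ?thesis using same[of xs] t(2) lx 2 m by simp
  next
    case 3
    have "left_end ((xs @ [x]) @ y # ys) l' y = sum_list (map l' (xs @ [x]))"
      using d by (intro left_end_append) auto
    then show ?thesis using same[of xs] t(2) lx 3 m unfolding l'_def by simp
  next
    case 4
    then obtain us vs where ys: "ys = us @ z # vs" by (meson split_list)
    have "left_end ((xs @ x # y # us) @ z # vs) l' z = sum_list (map l' (xs @ x # y # us))"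
      using d ys by (intro left_end_append) auto
    moreover have "left_end ((xs @ x # us) @ z # vs @ [y]) l z = sum_list (map l (xs @ x # us))"
      using d ys by (intro left_end_append) auto
    moreover have "z \<noteq> y" using 4 d by auto
    moreover have "l' y = l y" using d unfolding l'_def by auto
    moreover have "l' x = l x - l y" unfolding l'_def by simp
    ultimately show ?thesis using same[of us] same[of xs] d unfolding m unfolding ty ys by simp
  qed
  then show ?thesis unfolding l'_def y_def .
qed

lemma left_end_shrink_last:
  assumes "distinct t" "t \<noteq> []" "z \<in> set t"
  shows "left_end t (l(last t := w)) z = left_end t l z"
proof -
  obtain xs ys where t: "t = xs @ z # ys" "z \<notin> set xs"
    using assms(3) by (meson split_list_first)
  have "last t \<notin> set xs"
    using assms(1) t(1) by (cases ys rule: rev_cases) auto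
  then have "map (l(last t := w)) xs = map l xs" by auto
  then have "left_end (xs @ z # ys) (l(last t := w)) z = left_end (xs @ z # ys) l z"
    by (simp only: left_end_append[OF t(2)])
  then show ?thesis using t(1) by simp
qed

section \<open>Rauzy induction and invariant measures\<close>

text \<open>Invariance under the exchange, tested only on pieces of intervals that are translated as
  a whole. In this form it survives a Rauzy step by comparing endpoints, without a first return
  map.\<close>

definition transinv :: "real measure \<Rightarrow> nat list \<Rightarrow> nat list \<Rightarrow> (nat \<Rightarrow> real) \<Rightarrow> bool" where
  "transinv \<mu> t b l \<longleftrightarrow> (\<forall>x\<in>set t. \<forall>u v. 0 \<le> u \<longrightarrow> u \<le> v \<longrightarrow> v \<le> l x \<longrightarrow>
     measure \<mu> {left_end t l x + u..<left_end t l x + v} = measure \<mu> {left_end b l x + u..<left_end b l x + v})"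

text \<open>A pair \<open>(x, y)\<close> encodes the floor \<open>{y..<y + l x}\<close> of the Rauzy tower over the interval with letter \<open>x\<close>.
  Floors of the tower are translates of its base, and this is expressed only through the measures.\<close>
definition floor_family :: "real measure set \<Rightarrow> nat list \<Rightarrow> (nat \<Rightarrow> real) \<Rightarrow> (nat \<times> real) set \<Rightarrow> bool" where
  "floor_family Ms t l F \<longleftrightarrow> finite F \<and> fst ` F \<subseteq> set t \<and>
     {0..<1} \<subseteq> (\<Union>(x, y)\<in>F. {y..<y + l x}) \<and>
     (\<forall>\<mu>\<in>Ms. \<forall>(x, y)\<in>F. \<forall>u v. 0 \<le> u \<longrightarrow> u \<le> v \<longrightarrow> v \<le> l x \<longrightarrow>
        measure \<mu> {y + u..<y + v} = measure \<mu> {left_end t l x + u..<left_end t l x + v})"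

text \<open>The invariant kept along the Rauzy path. The floors are chosen once for all measures in
  \<open>Ms\<close>, so that two measures can later be compared on the same floors.\<close>

definition good_state :: "real measure set \<Rightarrow> rstate \<Rightarrow> bool" where
  "good_state Ms s = (case s of (t, b, l) \<Rightarrow>
     distinct t \<and> distinct b \<and> set t = set b \<and> t \<noteq> [] \<and> (\<forall>x\<in>set t. 0 < l x) \<and>
     (\<forall>\<mu>\<in>Ms. transinv \<mu> t b l) \<and> (\<exists>F. floor_family Ms t l F))"

text \<open>The value 0 off the row lets one Rauzy step be an equation between functions: for a
  foreign label \<open>left_end\<close> would be the total length, which changes in the
  step.\<close>

definition mlen :: "real measure \<Rightarrow> nat list \<Rightarrow> (nat \<Rightarrow> real) \<Rightarrow> nat \<Rightarrow> real" where
  "mlen \<mu> t l x = (if x \<in> set t then measure \<mu> {left_end t l x..<left_end t l x + l x} else 0)"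

definition mstate :: "real measure \<Rightarrow> rstate \<Rightarrow> rstate" where
  "mstate \<mu> s = (case s of (t, b, l) \<Rightarrow> (t, b, mlen \<mu> t l))"

text \<open>Rauzy induction of prescribed type. The measures of the exchanged intervals change like the lengths, but the
  type of the step is dictated by the lengths.\<close>
definition astep :: "nat \<Rightarrow> rstate \<Rightarrow> rstate" where
  "astep d s = (case s of (t, b, L) \<Rightarrow>
     if d = 0 then (t, move_after b (last t) (last b), L(last t := L (last t) - L (last b)))
     else (move_after t (last b) (last t), b, L(last b := L (last b) - L (last t))))"

lemma measure_Ico_split:
  fixes \<mu> :: "real measure"
  assumes "prob_space \<mu>" "sets \<mu> = sets borel" "a \<le> b" "b \<le> c"
  shows "measure \<mu> {a..<c} = measure \<mu> {a..<b} + measure \<mu> {b..<c}"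
proof -
  interpret prob_space \<mu> by fact
  have "{a..<c} = {a..<b} \<union> {b..<c}" using assms by auto
  then show ?thesis
    using finite_measure_Union[of "{a..<b}" "{b..<c}"] assms(2) by auto
qed

text \<open>Only the loser \<open>\<beta>\<close> needs an argument. The exchange carries its
  interval to the right end of the domain, which is the tail of the winner \<open>\<alpha>\<close>,
  and then carries this tail into the image of \<open>\<alpha>\<close>, the new place of
  \<open>\<beta>\<close> in the bottom row. Invariance is used once for each of the two
  passages.\<close>

lemma transinv_move:
  assumes "distinct t" "distinct b" "set t = set b" "t \<noteq> []" "\<forall>x\<in>set t. 0 < l x"
    and inv: "transinv \<mu> t b l" and less: "l (last b) < l (last t)"
  shows "transinv \<mu> t (move_after b (last t) (last b)) (l(last t := l (last t) - l (last b)))"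
  unfolding transinv_def
proof (intro ballI allI impI)
  define \<alpha> \<beta> where "\<alpha> = last t" and "\<beta> = last b"
  have bne: "b \<noteq> []" using assms(3,4) by auto
  then have "\<beta> \<in> set t" unfolding \<beta>_def assms(3) by simp
  then have ab: "\<alpha> \<in> set t" "\<beta> \<in> set t" "\<alpha> \<noteq> \<beta>" "b \<noteq> []"
    using assms bne by (auto simp: \<alpha>_def \<beta>_def)
  fix x u v
  assume x: "x \<in> set t" and uv: "0 \<le> u" "u \<le> v"
    and v: "v \<le> (l(last t := l (last t) - l (last b))) x"
  let ?l = "l(last t := l (last t) - l (last b))"
  have lt: "left_end t ?l x = left_end t l x"
    using assms(1,4) x by (rule left_end_shrink_last)
  have lb: "left_end (move_after b \<alpha> \<beta>) (l(\<alpha> := l \<alpha> - l \<beta>)) x =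
     (if x = \<beta> then left_end b l \<alpha> + l \<alpha> - l \<beta> else left_end b l x)"
    unfolding \<beta>_def using assms ab x by (intro left_end_move_after) (auto simp: \<beta>_def)
  \<comment> \<open>Both rows have the same letters, hence the same total length, so their last
    intervals end at the same point.\<close>
  have last: "left_end t l \<alpha> + l \<alpha> = left_end b l \<beta> + l \<beta>"
    using left_end_last[of t l] left_end_last[of b l] assms ab by (simp add: \<alpha>_def \<beta>_def)
  have inv': "measure \<mu> {left_end t l x + u..<left_end t l x + v} = measure \<mu> {left_end b l x + u..<left_end b l x + v}"
    if "x \<in> set t" "0 \<le> u" "u \<le> v" "v \<le> l x" for x u v
    using inv that unfolding transinv_def by blast
  have pos: "0 < l \<beta>" "l \<beta> < l \<alpha>" using assms(5) ab less by (auto simp: \<alpha>_def \<beta>_def)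
  have "measure \<mu> {left_end t l x + u..<left_end t l x + v} =
     measure \<mu> {left_end (move_after b \<alpha> \<beta>) (l(\<alpha> := l \<alpha> - l \<beta>)) x + u..<left_end (move_after b \<alpha> \<beta>) (l(\<alpha> := l \<alpha> - l \<beta>)) x + v}"
  proof (cases "x = \<beta>")
    case True
    then have v': "v \<le> l \<beta>" using v ab by (auto simp: \<alpha>_def \<beta>_def)
    have "measure \<mu> {left_end t l \<beta> + u..<left_end t l \<beta> + v} = measure \<mu> {left_end b l \<beta> + u..<left_end b l \<beta> + v}"
      using ab uv v' by (intro inv')
    also have "\<dots> = measure \<mu> {left_end t l \<alpha> + (l \<alpha> - l \<beta> + u)..<left_end t l \<alpha> + (l \<alpha> - l \<beta> + v)}"
      using last by (intro arg_cong[where f = "measure \<mu>"]) auto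
    also have "\<dots> = measure \<mu> {left_end b l \<alpha> + (l \<alpha> - l \<beta> + u)..<left_end b l \<alpha> + (l \<alpha> - l \<beta> + v)}"
      using ab uv v' pos by (intro inv') auto
    finally have "measure \<mu> {left_end t l \<beta> + u..<left_end t l \<beta> + v} =
      measure \<mu> {left_end b l \<alpha> + (l \<alpha> - l \<beta>) + u..<left_end b l \<alpha> + (l \<alpha> - l \<beta>) + v}"
      by (simp only: add.assoc)
    moreover have "left_end (move_after b \<alpha> \<beta>) (l(\<alpha> := l \<alpha> - l \<beta>)) x = left_end b l \<alpha> + (l \<alpha> - l \<beta>)"
      using lb True by simp
    ultimately show ?thesis using True by simp
  next
    case False
    have "v \<le> l x" using v pos by (auto simp: \<alpha>_def \<beta>_def split: if_splits)
    then show ?thesis using inv'[OF x uv] False lb by simp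
  qed
  then show "measure \<mu> {left_end t ?l x + u..<left_end t ?l x + v} =
    measure \<mu> {left_end (move_after b (last t) (last b)) ?l x + u..<left_end (move_after b (last t) (last b)) ?l x + v}"
    using lt by (simp add: \<alpha>_def \<beta>_def)
qed

text \<open>Swapping the rows passes to the inverse exchange. This reduces the step won by the
  bottom letter to \<open>transinv_move\<close>.\<close>

lemma transinv_sym:
  assumes "set t = set b" "transinv \<mu> b t l"
  shows "transinv \<mu> t b l"
  unfolding transinv_def
proof (intro ballI allI impI)
  fix x u v assume "x \<in> set t" "0 \<le> u" "u \<le> v" "v \<le> l x"
  then show "measure \<mu> {left_end t l x + u..<left_end t l x + v} = measure \<mu> {left_end b l x + u..<left_end b l x + v}"
    using assms(2)[unfolded transinv_def, rule_format, of x u v] assms(1) by simp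
qed

text \<open>Every floor over the winner \<open>w\<close> is cut: its left part stays over
  \<open>w\<close>, its right part of length \<open>l z\<close> becomes a floor over the loser
  \<open>z\<close>. The hypotheses \<open>loser\<close> and \<open>tail\<close> cover both types of
  step at once: the base of \<open>z\<close> stays in place when the top letter wins, and moves to
  the tail of \<open>w\<close> when the bottom letter wins.\<close>

lemma floor_family_split:
  assumes F: "floor_family Ms t l F" and wz: "w \<in> set t" "z \<in> set t" "w \<noteq> z" "0 < l z" "l z < l w"
    and t': "set t' = set t"
    and same: "\<And>x. x \<in> set t \<Longrightarrow> x \<noteq> z \<Longrightarrow> left_end t' (l(w := l w - l z)) x = left_end t l x"
    and loser: "\<And>\<mu> u v. \<lbrakk>\<mu> \<in> Ms; 0 \<le> u; u \<le> v; v \<le> l z\<rbrakk> \<Longrightarrow>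
      measure \<mu> {left_end t l z + u..<left_end t l z + v} =
      measure \<mu> {left_end t' (l(w := l w - l z)) z + u..<left_end t' (l(w := l w - l z)) z + v}"
    and tail: "\<And>\<mu> u v. \<lbrakk>\<mu> \<in> Ms; 0 \<le> u; u \<le> v; v \<le> l z\<rbrakk> \<Longrightarrow>
      measure \<mu> {left_end t l w + (l w - l z + u)..<left_end t l w + (l w - l z + v)} =
      measure \<mu> {left_end t l z + u..<left_end t l z + v}"
  shows "\<exists>F'. floor_family Ms t' (l(w := l w - l z)) F'"
proof
  define l' where "l' = l(w := l w - l z)"
  have l': "l' w = l w - l z" "\<And>x. x \<noteq> w \<Longrightarrow> l' x = l x" unfolding l'_def by auto
  define F' where "F' = F \<union> (\<lambda>y. (z, y + (l w - l z))) ` {y. (w, y) \<in> F}"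
  have fin: "finite F" and dom: "fst ` F \<subseteq> set t" and cov: "{0..<1} \<subseteq> (\<Union>(x, y)\<in>F. {y..<y + l x})"
    using F unfolding floor_family_def by blast+
  have old: "measure \<mu> {y + u..<y + v} = measure \<mu> {left_end t l x + u..<left_end t l x + v}"
    if "\<mu> \<in> Ms" "(x, y) \<in> F" "0 \<le> u" "u \<le> v" "v \<le> l x" for \<mu> x y u v
    using F that unfolding floor_family_def by blast
  have "finite {y. (w, y) \<in> F}"
    by (rule finite_subset[OF _ finite_imageI[OF fin, of snd]]) force
  then have "finite F'" unfolding F'_def using fin by blast
  moreover have "fst ` F' \<subseteq> set t'"
    using dom wz(2) unfolding F'_def t' by auto
  moreover have "{0..<1} \<subseteq> (\<Union>(x, y)\<in>F'. {y..<y + l' x})"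
  proof
    fix q :: real assume "q \<in> {0..<1}"
    then have "q \<in> (\<Union>(x, y)\<in>F. {y..<y + l x})" using cov by blast
    then obtain x y where xy: "(x, y) \<in> F" "y \<le> q" "q < y + l x" by auto
    show "q \<in> (\<Union>(x, y)\<in>F'. {y..<y + l' x})"
    proof (cases "x = w \<and> y + (l w - l z) \<le> q")
      case True
      then have "(z, y + (l w - l z)) \<in> F'" using xy unfolding F'_def by blast
      moreover have "q \<in> {y + (l w - l z)..<y + (l w - l z) + l' z}"
        using xy True wz(3) l'(2)[of z] by auto
      ultimately show ?thesis by blast
    next
      case False
      then have "q \<in> {y..<y + l' x}" using xy l' by (cases "x = w") auto
      moreover have "(x, y) \<in> F'" using xy unfolding F'_def by blast
      ultimately show ?thesis by blast
    qed
  qed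
  moreover have "measure \<mu> {y + u..<y + v} = measure \<mu> {left_end t' l' x + u..<left_end t' l' x + v}"
    if \<mu>: "\<mu> \<in> Ms" and xy: "(x, y) \<in> F'" and uv: "0 \<le> u" "u \<le> v" "v \<le> l' x" for \<mu> x y u v
  proof -
    consider "(x, y) \<in> F" | q where "(w, q) \<in> F" "x = z" "y = q + (l w - l z)"
      using xy unfolding F'_def by blast
    then show ?thesis
    proof cases
      case 1
      have "x \<in> set t" using 1 dom by force
      have v: "v \<le> l x" using uv(3) l' wz(4) by (cases "x = w") auto
      note o = old[OF \<mu> 1 uv(1,2) v]
      show ?thesis
      proof (cases "x = z")
        case True
        show ?thesis using o loser[OF \<mu> uv(1,2)] v unfolding True l'_def by metis
      next
        case False
        show ?thesis unfolding o l'_def same[OF \<open>x \<in> set t\<close> False] ..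
      qed
    next
      case 2
      have v: "v \<le> l z" using uv(3) l'(2)[of z] wz(3) 2 by simp
      have "measure \<mu> {q + (l w - l z + u)..<q + (l w - l z + v)} =
          measure \<mu> {left_end t l w + (l w - l z + u)..<left_end t l w + (l w - l z + v)}"
        using uv v wz by (intro old[OF \<mu> 2(1)]) auto
      also have "\<dots> = measure \<mu> {left_end t l z + u..<left_end t l z + v}"
        using uv v \<mu> by (intro tail)
      also have "\<dots> = measure \<mu> {left_end t' l' z + u..<left_end t' l' z + v}"
        unfolding l'_def using uv v \<mu> by (intro loser)
      finally show ?thesis unfolding 2(2,3) add.assoc .
    qed
  qed
  ultimately show "floor_family Ms t' (l(w := l w - l z)) F'"
    unfolding floor_family_def l'_def by blast
qed

lemma good_top:
  assumes g: "good_state Ms (t, b, l)" and less: "l (last b) < l (last t)"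
    and Ms: "\<forall>\<mu>\<in>Ms. prob_space \<mu> \<and> sets \<mu> = sets borel"
  shows "good_state Ms (t, move_after b (last t) (last b), l(last t := l (last t) - l (last b)))"
    and "\<forall>\<mu>\<in>Ms. mlen \<mu> t (l(last t := l (last t) - l (last b))) =
           (mlen \<mu> t l)(last t := mlen \<mu> t l (last t) - mlen \<mu> t l (last b))"
proof -
  define \<alpha> \<beta> where "\<alpha> = last t" and "\<beta> = last b"
  define l' where "l' = l(\<alpha> := l \<alpha> - l \<beta>)"
  have A: "distinct t" "distinct b" "set t = set b" "t \<noteq> []" "\<forall>x\<in>set t. 0 < l x"
    and inv: "\<forall>\<mu>\<in>Ms. transinv \<mu> t b l" and exF: "\<exists>F. floor_family Ms t l F"
    using g unfolding good_state_def by auto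
  have bne: "b \<noteq> []" using A(3,4) by auto
  then have "\<beta> \<in> set t" unfolding \<beta>_def A(3) by simp
  then have ab: "\<alpha> \<in> set t" "\<beta> \<in> set t" "\<alpha> \<noteq> \<beta>" "b \<noteq> []"
    using A(4) bne less by (auto simp: \<alpha>_def \<beta>_def)
  have pos: "0 < l \<beta>" "l \<beta> < l \<alpha>" using A ab less by (auto simp: \<alpha>_def \<beta>_def)
  have lt: "left_end t l' x = left_end t l x" if "x \<in> set t" for x
    unfolding l'_def \<alpha>_def using A that by (intro left_end_shrink_last) auto
  have last: "left_end t l \<alpha> + l \<alpha> = left_end b l \<beta> + l \<beta>"
    using left_end_last[of t l] left_end_last[of b l] A ab by (simp add: \<alpha>_def \<beta>_def)
  have inv': "measure \<mu> {left_end t l x + u..<left_end t l x + v} = measure \<mu> {left_end b l x + u..<left_end b l x + v}"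
    if "\<mu> \<in> Ms" "x \<in> set t" "0 \<le> u" "u \<le> v" "v \<le> l x" for \<mu> x u v
    using inv that unfolding transinv_def by blast
  \<comment> \<open>The exchange maps the interval of the loser onto the tail of the winner, since
    both rows end at the same point.\<close>
  have tail: "measure \<mu> {left_end t l \<alpha> + (l \<alpha> - l \<beta> + u)..<left_end t l \<alpha> + (l \<alpha> - l \<beta> + v)} =
      measure \<mu> {left_end t l \<beta> + u..<left_end t l \<beta> + v}"
    if "\<mu> \<in> Ms" "0 \<le> u" "u \<le> v" "v \<le> l \<beta>" for \<mu> u v
  proof -
    have "measure \<mu> {left_end t l \<beta> + u..<left_end t l \<beta> + v} = measure \<mu> {left_end b l \<beta> + u..<left_end b l \<beta> + v}"
      using ab that by (intro inv')
    also have "\<dots> = measure \<mu> {left_end t l \<alpha> + (l \<alpha> - l \<beta> + u)..<left_end t l \<alpha> + (l \<alpha> - l \<beta> + v)}"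
      using last by (intro arg_cong[where f = "measure \<mu>"]) auto
    finally show ?thesis by simp
  qed
  obtain F where F: "floor_family Ms t l F" using exF by blast
  have "\<exists>F'. floor_family Ms t (l(\<alpha> := l \<alpha> - l \<beta>)) F'"
    using F ab(1-3) pos lt tail by (intro floor_family_split[where t = t and F = F]) (auto simp: l'_def)
  moreover have "distinct (move_after b \<alpha> \<beta>)" "set (move_after b \<alpha> \<beta>) = set b"
    using A ab distinct_move_after[of b \<alpha>] by (auto simp: \<beta>_def)
  moreover have "\<forall>x\<in>set t. 0 < l' x" using A pos by (auto simp: l'_def)
  moreover have "\<forall>\<mu>\<in>Ms. transinv \<mu> t (move_after b \<alpha> \<beta>) l'"
    unfolding l'_def \<alpha>_def \<beta>_def using A inv less by (auto intro!: transinv_move)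
  ultimately show "good_state Ms (t, move_after b (last t) (last b), l(last t := l (last t) - l (last b)))"
    using A unfolding good_state_def l'_def \<alpha>_def \<beta>_def by auto
  show "\<forall>\<mu>\<in>Ms. mlen \<mu> t (l(last t := l (last t) - l (last b))) =
           (mlen \<mu> t l)(last t := mlen \<mu> t l (last t) - mlen \<mu> t l (last b))"
  proof
    fix \<mu> assume \<mu>: "\<mu> \<in> Ms"
    have "measure \<mu> {left_end t l \<alpha>..<left_end t l \<alpha> + l \<alpha>} =
       measure \<mu> {left_end t l \<alpha>..<left_end t l \<alpha> + (l \<alpha> - l \<beta>)} +
       measure \<mu> {left_end t l \<alpha> + (l \<alpha> - l \<beta>)..<left_end t l \<alpha> + l \<alpha>}"
      using Ms \<mu> pos by (intro measure_Ico_split) auto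
    also have "measure \<mu> {left_end t l \<alpha> + (l \<alpha> - l \<beta>)..<left_end t l \<alpha> + l \<alpha>} =
       measure \<mu> {left_end t l \<beta>..<left_end t l \<beta> + l \<beta>}"
      using tail[of \<mu> 0 "l \<beta>"] \<mu> pos by simp
    finally have "mlen \<mu> t l' \<alpha> = mlen \<mu> t l \<alpha> - mlen \<mu> t l \<beta>"
      using ab lt by (simp add: mlen_def l'_def)
    moreover have "mlen \<mu> t l' x = mlen \<mu> t l x" if "x \<noteq> \<alpha>" for x
      using that lt by (simp add: mlen_def l'_def)
    ultimately show "mlen \<mu> t (l(last t := l (last t) - l (last b))) =
           (mlen \<mu> t l)(last t := mlen \<mu> t l (last t) - mlen \<mu> t l (last b))"
      unfolding fun_eq_iff by (auto simp: \<alpha>_def \<beta>_def l'_def)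
  qed
qed

text \<open>Here the loser \<open>\<alpha>\<close> is the rightmost domain interval and is cut off.
  Its label passes to the tail of the winner, which the exchange maps onto the interval cut off, so
  the measure attached to the label does not change.\<close>

lemma good_bot:
  assumes g: "good_state Ms (t, b, l)" and less: "l (last t) < l (last b)"
    and Ms: "\<forall>\<mu>\<in>Ms. prob_space \<mu> \<and> sets \<mu> = sets borel"
  shows "good_state Ms (move_after t (last b) (last t), b, l(last b := l (last b) - l (last t)))"
    and "\<forall>\<mu>\<in>Ms. mlen \<mu> (move_after t (last b) (last t)) (l(last b := l (last b) - l (last t))) =
           (mlen \<mu> t l)(last b := mlen \<mu> t l (last b) - mlen \<mu> t l (last t))"
proof -
  define \<alpha> \<beta> where "\<alpha> = last t" and "\<beta> = last b"
  define l' where "l' = l(\<beta> := l \<beta> - l \<alpha>)"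
  define t' where "t' = move_after t \<beta> \<alpha>"
  have A: "distinct t" "distinct b" "set t = set b" "t \<noteq> []" "\<forall>x\<in>set t. 0 < l x"
    and inv: "\<forall>\<mu>\<in>Ms. transinv \<mu> t b l" and exF: "\<exists>F. floor_family Ms t l F"
    using g unfolding good_state_def by auto
  have bne: "b \<noteq> []" using A(3,4) by auto
  then have "\<beta> \<in> set t" unfolding \<beta>_def A(3) by simp
  then have ab: "\<alpha> \<in> set t" "\<beta> \<in> set t" "\<alpha> \<noteq> \<beta>" "b \<noteq> []"
    using A(4) bne less by (auto simp: \<alpha>_def \<beta>_def)
  have pos: "0 < l \<alpha>" "l \<alpha> < l \<beta>" using A ab less by (auto simp: \<alpha>_def \<beta>_def)
  have t': "distinct t'" "set t' = set t"
    using distinct_move_after[OF A(1) ab(2) A(4)] ab(3) unfolding t'_def \<alpha>_def by simp_all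
  have lt: "left_end t' l' x = (if x = \<alpha> then left_end t l \<beta> + l \<beta> - l \<alpha> else left_end t l x)"
    if "x \<in> set t" for x
    unfolding l'_def t'_def \<alpha>_def using A ab that by (intro left_end_move_after) (auto simp: \<alpha>_def)
  have lt_\<alpha>: "left_end t' l' \<alpha> = left_end t l \<beta> + (l \<beta> - l \<alpha>)"
    using lt[OF ab(1)] by simp
  have last: "left_end t l \<alpha> + l \<alpha> = left_end b l \<beta> + l \<beta>"
    using left_end_last[of t l] left_end_last[of b l] A ab by (simp add: \<alpha>_def \<beta>_def)
  have inv': "measure \<mu> {left_end t l x + u..<left_end t l x + v} = measure \<mu> {left_end b l x + u..<left_end b l x + v}"
    if "\<mu> \<in> Ms" "x \<in> set t" "0 \<le> u" "u \<le> v" "v \<le> l x" for \<mu> x u v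
    using inv that unfolding transinv_def by blast
  have tail: "measure \<mu> {left_end t l \<beta> + (l \<beta> - l \<alpha> + u)..<left_end t l \<beta> + (l \<beta> - l \<alpha> + v)} =
      measure \<mu> {left_end t l \<alpha> + u..<left_end t l \<alpha> + v}"
    if "\<mu> \<in> Ms" "0 \<le> u" "u \<le> v" "v \<le> l \<alpha>" for \<mu> u v
  proof -
    have "measure \<mu> {left_end t l \<beta> + (l \<beta> - l \<alpha> + u)..<left_end t l \<beta> + (l \<beta> - l \<alpha> + v)} =
       measure \<mu> {left_end b l \<beta> + (l \<beta> - l \<alpha> + u)..<left_end b l \<beta> + (l \<beta> - l \<alpha> + v)}"
      using ab that pos by (intro inv') auto
    also have "\<dots> = measure \<mu> {left_end t l \<alpha> + u..<left_end t l \<alpha> + v}"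
      using last by (intro arg_cong[where f = "measure \<mu>"]) auto
    finally show ?thesis .
  qed
  obtain F where F: "floor_family Ms t l F" using exF by blast
  have loser: "measure \<mu> {left_end t l \<alpha> + u..<left_end t l \<alpha> + v} =
      measure \<mu> {left_end t' l' \<alpha> + u..<left_end t' l' \<alpha> + v}"
    if "\<mu> \<in> Ms" "0 \<le> u" "u \<le> v" "v \<le> l \<alpha>" for \<mu> u v
    unfolding lt_\<alpha> add.assoc using that by (intro tail[symmetric])
  have "\<exists>F'. floor_family Ms t' (l(\<beta> := l \<beta> - l \<alpha>)) F'"
  proof (rule floor_family_split[OF F ab(2,1) ab(3)[symmetric] pos t'(2)])
    show "left_end t' (l(\<beta> := l \<beta> - l \<alpha>)) x = left_end t l x" if "x \<in> set t" "x \<noteq> \<alpha>" for x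
      using lt[OF that(1)] that(2) by (simp add: l'_def)
  qed (fact loser[unfolded l'_def] tail)+
  moreover have "\<forall>x\<in>set t. 0 < l' x" using A pos by (auto simp: l'_def)
  moreover have "\<forall>\<mu>\<in>Ms. transinv \<mu> t' b l'"
  proof
    fix \<mu> assume "\<mu> \<in> Ms"
    then have "transinv \<mu> b t l" using inv A(3) \<open>\<mu> \<in> Ms\<close> transinv_sym[of b t \<mu> l] by simp
    then have "transinv \<mu> b t' l'"
      unfolding l'_def \<alpha>_def \<beta>_def t'_def using A ab less by (intro transinv_move) auto
    then show "transinv \<mu> t' b l'" using t'(2) A(3) transinv_sym[of t' b \<mu> l'] by simp
  qed
  moreover have "t' \<noteq> []" using t'(2) A(4) by (metis set_empty)
  ultimately show "good_state Ms (move_after t (last b) (last t), b, l(last b := l (last b) - l (last t)))"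
    using A t' unfolding good_state_def l'_def \<alpha>_def \<beta>_def t'_def by auto
  show "\<forall>\<mu>\<in>Ms. mlen \<mu> (move_after t (last b) (last t)) (l(last b := l (last b) - l (last t))) =
           (mlen \<mu> t l)(last b := mlen \<mu> t l (last b) - mlen \<mu> t l (last t))"
  proof
    fix \<mu> assume \<mu>: "\<mu> \<in> Ms"
    have tl: "measure \<mu> {left_end t l \<beta> + (l \<beta> - l \<alpha>)..<left_end t l \<beta> + l \<beta>} =
       measure \<mu> {left_end t l \<alpha>..<left_end t l \<alpha> + l \<alpha>}"
      using tail[of \<mu> 0 "l \<alpha>"] \<mu> pos by simp
    have "measure \<mu> {left_end t l \<beta>..<left_end t l \<beta> + l \<beta>} =
       measure \<mu> {left_end t l \<beta>..<left_end t l \<beta> + (l \<beta> - l \<alpha>)} +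
       measure \<mu> {left_end t l \<beta> + (l \<beta> - l \<alpha>)..<left_end t l \<beta> + l \<beta>}"
      using Ms \<mu> pos by (intro measure_Ico_split) auto
    then have "mlen \<mu> t' l' \<beta> = mlen \<mu> t l \<beta> - mlen \<mu> t l \<alpha>"
      using ab lt[of \<beta>] t' tl by (simp add: mlen_def l'_def)
    moreover have "mlen \<mu> t' l' x = mlen \<mu> t l x" if "x \<noteq> \<beta>" for x
    proof (cases "x = \<alpha>")
      case True
      have "left_end t' l' \<alpha> + l' \<alpha> = left_end t l \<beta> + l \<beta>" using lt_\<alpha> ab(3) by (simp add: l'_def)
      then show ?thesis using True lt_\<alpha> tl ab(1) t'(2) by (simp add: mlen_def)
    next
      case False
      then show ?thesis using that lt[of x] t' by (auto simp: mlen_def l'_def)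
    qed
    ultimately show "mlen \<mu> (move_after t (last b) (last t)) (l(last b := l (last b) - l (last t))) =
           (mlen \<mu> t l)(last b := mlen \<mu> t l (last b) - mlen \<mu> t l (last t))"
      unfolding fun_eq_iff by (auto simp: \<alpha>_def \<beta>_def l'_def t'_def)
  qed
qed

lemma good_rauzy_step:
  assumes "good_state Ms s" "rauzy_type s = Some d"
    and Ms: "\<forall>\<mu>\<in>Ms. prob_space \<mu> \<and> sets \<mu> = sets borel"
  shows "good_state Ms (rauzy_step s)" "\<forall>\<mu>\<in>Ms. mstate \<mu> (rauzy_step s) = astep d (mstate \<mu> s)"
proof -
  obtain t b l where s: "s = (t, b, l)" by (cases s)
  have "good_state Ms (rauzy_step s) \<and> (\<forall>\<mu>\<in>Ms. mstate \<mu> (rauzy_step s) = astep d (mstate \<mu> s))"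
  proof (cases "l (last t) > l (last b)")
    case True
    then have "d = 0" using assms(2) by (simp add: rauzy_type_def s)
    then show ?thesis
      using good_top[OF assms(1)[unfolded s] True Ms] True
      by (simp add: rauzy_step_def astep_def mstate_def Let_def s)
  next
    case False
    then have less: "l (last t) < l (last b)" and d: "d = 1"
      using assms(2) by (auto simp: rauzy_type_def s split: if_splits)
    then show ?thesis
      using good_bot[OF assms(1)[unfolded s] less Ms] False
      by (simp add: rauzy_step_def astep_def mstate_def Let_def s)
  qed
  then show "good_state Ms (rauzy_step s)" "\<forall>\<mu>\<in>Ms. mstate \<mu> (rauzy_step s) = astep d (mstate \<mu> s)"
    by auto
qed

lemma good_rauzy_path:
  assumes "good_state Ms s" "\<And>r. r < length ds \<Longrightarrow> rauzy_type ((rauzy_step ^^ r) s) = Some (ds ! r)"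
    and Ms: "\<forall>\<mu>\<in>Ms. prob_space \<mu> \<and> sets \<mu> = sets borel"
  shows "good_state Ms ((rauzy_step ^^ length ds) s) \<and>
    (\<forall>\<mu>\<in>Ms. mstate \<mu> ((rauzy_step ^^ length ds) s) = fold astep ds (mstate \<mu> s))"
  using assms(1,2)
proof (induction ds arbitrary: s)
  case Nil
  then show ?case by simp
next
  case (Cons d ds)
  have d: "rauzy_type s = Some d" using Cons.prems(2)[of 0] by simp
  note step = good_rauzy_step[OF Cons.prems(1) d Ms]
  have "rauzy_type ((rauzy_step ^^ r) (rauzy_step s)) = Some (ds ! r)" if "r < length ds" for r
    using Cons.prems(2)[of "Suc r"] that by (simp add: funpow_swap1)
  from Cons.IH[OF step(1) this] step(2) show ?case
    by (simp add: funpow_swap1)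
qed

text \<open>Disjointness of the floors is not needed: take the floor through the left end of the interval with the largest
  right end, and any floor through that right end.\<close>
lemma floor_family_Ico:
  assumes F: "floor_family Ms t l F" and xy: "0 \<le> x" "x < y" "y \<le> 1"
    and no: "\<And>z w. (z, w) \<in> F \<Longrightarrow> \<not> (x \<le> w \<and> w + l z \<le> y)"
  shows "\<exists>z w z' w'. (z, w) \<in> F \<and> (z', w') \<in> F \<and> {x..<y} \<subseteq> {w..<w + l z} \<union> {w'..<w' + l z'}"
proof -
  have cov: "\<exists>f\<in>F. snd f \<le> z \<and> z < snd f + l (fst f)" if "0 \<le> z" "z < 1" for z
  proof -
    have "{0..<1} \<subseteq> (\<Union>(x, y)\<in>F. {y..<y + l x})" using F unfolding floor_family_def by blast
    moreover have "z \<in> {0..<1}" using that by simp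
    ultimately have "z \<in> (\<Union>(x, y)\<in>F. {y..<y + l x})" by (rule subsetD)
    then obtain f where "f \<in> F" "z \<in> {snd f..<snd f + l (fst f)}" by (auto simp: case_prod_beta)
    then show ?thesis by auto
  qed
  have fin: "finite F" using F unfolding floor_family_def by auto
  define G where "G = {f\<in>F. snd f \<le> x \<and> x < snd f + l (fst f)}"
  have "finite G" using fin by (simp add: G_def)
  moreover have "x < 1" using xy by simp
  then have "G \<noteq> {}" using cov[OF xy(1)] unfolding G_def by blast
  ultimately have "Max ((\<lambda>g. snd g + l (fst g)) ` G) \<in> (\<lambda>g. snd g + l (fst g)) ` G"
    by (intro Max_in) auto
  then obtain f where f: "f \<in> G" and fm: "Max ((\<lambda>g. snd g + l (fst g)) ` G) = snd f + l (fst f)"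
    by blast
  have fmax: "snd g + l (fst g) \<le> snd f + l (fst f)" if "g \<in> G" for g
    unfolding fm[symmetric] using that \<open>finite G\<close> by (intro Max_ge) auto
  show ?thesis
  proof (cases "y \<le> snd f + l (fst f)")
    case True
    then show ?thesis using f
      by (intro exI[of _ "fst f"] exI[of _ "snd f"] exI[of _ "fst f"] exI[of _ "snd f"]) (auto simp: G_def)
  next
    case False
    then obtain g where g: "g \<in> F" "snd g \<le> snd f + l (fst f)" "snd f + l (fst f) < snd g + l (fst g)"
      using cov[of "snd f + l (fst f)"] f xy by (auto simp: G_def)
    \<comment> \<open>A floor reaching further than \<open>f\<close> cannot contain
      \<open>x\<close>. It thus starts after \<open>x\<close>, and must end beyond \<open>y\<close>,
      as otherwise it would lie inside the interval.\<close>
    have "g \<notin> G" using fmax[of g] g(3) by (meson not_less)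
    then have "x < snd g" using g f xy by (auto simp: G_def)
    then have "y < snd g + l (fst g)" using no[of "fst g" "snd g"] g by auto
    then have "{x..<y} \<subseteq> {snd f..<snd f + l (fst f)} \<union> {snd g..<snd g + l (fst g)}"
      using f g by (auto simp: G_def)
    then show ?thesis using f g by (intro exI[of _ "fst f"] exI[of _ "snd f"] exI[of _ "fst g"] exI[of _ "snd g"])
        (auto simp: G_def)
  qed
qed

lemma floor_measure:
  assumes "floor_family Ms t l F" "\<mu> \<in> Ms" "(x, y) \<in> F" "\<forall>z\<in>set t. 0 < l z"
  shows "measure \<mu> {y..<y + l x} = mlen \<mu> t l x" "x \<in> set t"
proof -
  have "fst ` F \<subseteq> set t" using assms(1) unfolding floor_family_def by blast
  then show x: "x \<in> set t" using assms(3) by force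
  have *: "\<forall>u v. 0 \<le> u \<longrightarrow> u \<le> v \<longrightarrow> v \<le> l x \<longrightarrow>
        measure \<mu> {y + u..<y + v} = measure \<mu> {left_end t l x + u..<left_end t l x + v}"
    using assms unfolding floor_family_def by blast
  have "0 < l x" using assms(4) x by blast
  then show "measure \<mu> {y..<y + l x} = mlen \<mu> t l x"
    using *[rule_format, of 0 "l x"] x by (simp add: mlen_def)
qed

section \<open>The initial interval exchange\<close>

lemma iet_map_eq:
  assumes "distinct t" "\<forall>x\<in>set t. 0 < l x" "x \<in> set t" "left_end t l x \<le> z" "z < left_end t l x + l x"
  shows "iet_map t b l z = z - left_end t l x + left_end b l x"
proof -
  have uniq: "y = x" if "y \<in> set t" "left_end t l y \<le> z" "z < left_end t l y + l y" for y
    using left_end_disjoint[OF assms(1) that(1) assms(3) _ assms(2)] that(2,3) assms(4,5) by linarith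
  have "(SOME y. y \<in> set t \<and> left_end t l y \<le> z \<and> z < left_end t l y + l y) = x"
  proof (rule some_equality)
    show "x \<in> set t \<and> left_end t l x \<le> z \<and> z < left_end t l x + l x" using assms(3-5) by blast
  qed (use uniq in blast)
  moreover have "\<exists>y\<in>set t. left_end t l y \<le> z \<and> z < left_end t l y + l y" using assms(3-5) by blast
  ultimately show ?thesis unfolding iet_map_def Let_def by simp
qed

lemma iet_map_outside:
  assumes "distinct t" "\<forall>x\<in>set t. 0 < l x" "sum l (set t) = 1" "z \<notin> {0..<1}"
  shows "iet_map t b l z = z"
proof -
  have "\<not> (left_end t l x \<le> z \<and> z < left_end t l x + l x)" if "x \<in> set t" for x
    using left_end_bounds[OF assms(1) that assms(2)] assms(3,4) by auto
  then have "\<not> (\<exists>x\<in>set t. left_end t l x \<le> z \<and> z < left_end t l x + l x)" by blast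
  then show ?thesis unfolding iet_map_def by (simp only: if_False)
qed

lemma iet_map_measurable:
  assumes "distinct t" "\<forall>x\<in>set t. 0 < l x" "sum l (set t) = 1"
  shows "iet_map t b l \<in> borel_measurable borel"
proof -
  let ?I = "\<lambda>x. {left_end t l x..<left_end t l x + l x}"
  have "iet_map t b l = (\<lambda>z. (\<Sum>x\<in>set t. indicator (?I x) z * (z - left_end t l x + left_end b l x))
      + indicator (- {0..<1}) z * z)"
  proof
    fix z :: real
    show "iet_map t b l z = (\<Sum>x\<in>set t. indicator (?I x) z * (z - left_end t l x + left_end b l x))
      + indicator (- {0..<1}) z * z"
    proof (cases "z \<in> {0..<1}")
      case True
      then obtain x where x: "x \<in> set t" "left_end t l x \<le> z" "z < left_end t l x + l x"
        using left_end_cover[OF assms(1), of z l] assms(3) by auto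
      have "indicator (?I y) z = (0::real)" if "y \<in> set t - {x}" for y
        using left_end_disjoint[OF assms(1) _ x(1) _ assms(2), of y] that x by (auto simp: indicator_def)
      then have "(\<Sum>y\<in>set t. indicator (?I y) z * (z - left_end t l y + left_end b l y)) =
          indicator (?I x) z * (z - left_end t l x + left_end b l x)"
        using x(1) by (subst sum.remove[of _ x]) auto
      then show ?thesis using iet_map_eq[OF assms(1,2) x] x True by simp
    next
      case False
      have "indicator (?I y) z = (0::real)" if "y \<in> set t" for y
        using left_end_bounds[OF assms(1) that assms(2)] assms(3) False by (auto simp: indicator_def)
      then show ?thesis using iet_map_outside[OF assms False] False by simp
    qed
  qed
  also have "\<dots> \<in> borel_measurable borel" by measurable
  finally show ?thesis .
qed

text \<open>The images of distinct letters are disjoint, so within \<open>{0..<1}\<close> the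
  preimage of a piece of one image interval is a single translated interval. The rest of the line
  has measure zero.\<close>

lemma transinv_iet:
  assumes t: "distinct t" "distinct b" "set t = set b" "\<forall>x\<in>set t. 0 < l x" "sum l (set t) = 1"
    and M: "sets M = sets borel" "prob_space M" "emeasure M {0..<1} = 1"
    and inv: "distr M borel (iet_map t b l) = M"
  shows "transinv M t b l"
  unfolding transinv_def
proof (intro ballI allI impI)
  fix x u v
  assume x: "x \<in> set t" and uv: "0 \<le> u" "u \<le> v" "v \<le> l x"
  interpret prob_space M by fact
  let ?T = "iet_map t b l"
  let ?K = "{left_end t l x + u..<left_end t l x + v}" and ?K' = "{left_end b l x + u..<left_end b l x + v}"
  have T: "?T \<in> measurable M borel"
    using iet_map_measurable[OF t(1,4,5), of b] M(1) by (simp cong: measurable_cong_sets)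
  have sp: "space M = UNIV" using sets_eq_imp_space_eq[OF M(1)] by simp
  have pre: "?T -` ?K' \<inter> {0..<1} = ?K"
  proof
    show "?K \<subseteq> ?T -` ?K' \<inter> {0..<1}"
    proof
      fix z assume z: "z \<in> ?K"
      then have "?T z = z - left_end t l x + left_end b l x"
        using x uv by (intro iet_map_eq t) auto
      then show "z \<in> ?T -` ?K' \<inter> {0..<1}"
        using z uv left_end_bounds[OF t(1) x t(4)] t(5) by auto
    qed
    show "?T -` ?K' \<inter> {0..<1} \<subseteq> ?K"
    proof
      fix z assume z: "z \<in> ?T -` ?K' \<inter> {0..<1}"
      then obtain y where y: "y \<in> set t" "left_end t l y \<le> z" "z < left_end t l y + l y"
        using left_end_cover[OF t(1), of z l] t(5) by auto
      have Tz: "?T z = z - left_end t l y + left_end b l y"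
        using iet_map_eq[OF t(1,4) y] by simp
      have "y = x"
      proof (rule ccontr)
        assume "y \<noteq> x"
        then have "left_end b l y + l y \<le> left_end b l x \<or> left_end b l x + l x \<le> left_end b l y"
          using left_end_disjoint[OF t(2), of y x l] y(1) x t(3,4) by auto
        then show False using z Tz y uv by auto
      qed
      then show "z \<in> ?K" using z Tz by auto
    qed
  qed
  have "measure M ?K' = measure (distr M borel ?T) ?K'" using inv by simp
  also have "\<dots> = measure M (?T -` ?K' \<inter> space M)" using T by (intro measure_distr) auto
  also have "\<dots> = measure M (?T -` ?K' \<inter> {0..<1})"
  proof -
    have m1: "{0..<1} \<in> events" using M(1) by simp
    have "AE z in M. z \<in> {0..<1}"
      using M(3) m1 by (intro AE_prob_1) (simp add: measure_def)
    moreover have "?T -` ?K' \<inter> space M \<in> sets M" using T by (rule measurable_sets) auto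
    ultimately show ?thesis
      using m1 sp by (intro finite_measure_eq_AE) auto
  qed
  finally show "measure M ?K = measure M ?K'" unfolding pre by simp
qed

lemma pairs_props:
  fixes k :: nat
  defines "P \<equiv> concat (map (\<lambda>i. [2 * i + 1, 2 * i]) [1..<k + 1])"
  shows "set P = {2..2 * k + 1}" "distinct P"
proof -
  have "set (concat (map (\<lambda>i. [2 * i + 1, 2 * i]) [1..<k + 1])) = {2..2 * k + 1} \<and>
      distinct (concat (map (\<lambda>i. [2 * i + 1, 2 * i]) [1..<k + 1]))" for k :: nat
  proof (induction k)
    case (Suc k)
    have "{2..2 * Suc k + 1} = {2..2 * k + 1} \<union> {2 * k + 2, 2 * k + 3}" by auto
    then show ?case using Suc by auto
  qed simp
  then show "set P = {2..2 * k + 1}" "distinct P" unfolding P_def by blast+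
qed

lemma rows:
  assumes "even n" "4 \<le> n"
  shows "set (top_row n) = {1..n}" "distinct (top_row n)" "set (bot_row n) = {1..n}" "distinct (bot_row n)"
proof -
  define h where "h = (n - 2) div 2"
  have n: "n = 2 * h + 2" using assms by (auto simp: h_def)
  show "set (top_row n) = {1..n}" "distinct (top_row n)" unfolding top_row_def by auto
  have "{1..n} = {1, n} \<union> {2..2 * h + 1}" using n by auto
  then show "set (bot_row n) = {1..n}" "distinct (bot_row n)"
    using pairs_props[of h] n unfolding bot_row_def h_def[symmetric] by auto
qed

lemma good_initial:
  assumes n: "even n" "4 \<le> n" and l: "\<forall>r\<in>{1..n}. 0 < l r" "(\<Sum>r=1..n. l r) = 1"
    and M: "\<And>M. M \<in> Ms \<Longrightarrow> sets M = sets borel \<and> prob_space M \<and> emeasure M {0..<1} = 1 \<and>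
       distr M borel (iet_map (top_row n) (bot_row n) l) = M"
  shows "good_state Ms (top_row n, bot_row n, l)"
proof -
  note R = rows[OF n]
  \<comment> \<open>Before any induction each tower consists of its base alone.\<close>
  let ?F = "(\<lambda>x. (x, left_end (top_row n) l x)) ` {1..n}"
  have "{0..<1} \<subseteq> (\<Union>(x, y)\<in>?F. {y..<y + l x})"
  proof
    fix z :: real assume "z \<in> {0..<1}"
    then obtain x where "x \<in> set (top_row n)" "left_end (top_row n) l x \<le> z" "z < left_end (top_row n) l x + l x"
      using left_end_cover[OF R(2), of z l] R(1) l(2) by auto
    then show "z \<in> (\<Union>(x, y)\<in>?F. {y..<y + l x})" using R(1) by auto
  qed
  then have "floor_family Ms (top_row n) l ?F"
    unfolding floor_family_def using R by auto
  moreover have "\<forall>\<mu>\<in>Ms. transinv \<mu> (top_row n) (bot_row n) l"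
    using R l M by (intro ballI transinv_iet) auto
  moreover have "top_row n \<noteq> []" using n by (auto simp: top_row_def)
  ultimately show ?thesis using R l unfolding good_state_def by auto
qed

section \<open>The path gamma\<close>

lemma astep_0:
  "\<alpha> \<notin> set b1 \<Longrightarrow> astep 0 (t0 @ [\<alpha>], b1 @ \<alpha> # b2 @ [\<beta>], L) =
     (t0 @ [\<alpha>], b1 @ \<alpha> # \<beta> # b2, L(\<alpha> := L \<alpha> - L \<beta>))"
  by (simp add: astep_def move_after_eq)

lemma astep_1:
  "\<beta> \<notin> set t1 \<Longrightarrow> astep (Suc 0) (t1 @ \<beta> # t2 @ [\<alpha>], b0 @ [\<beta>], L) =
     (t1 @ \<beta> # \<alpha> # t2, b0 @ [\<beta>], L(\<beta> := L \<beta> - L \<alpha>))"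
  by (simp add: astep_def move_after_eq)

lemma sum_list_upd_notin: "\<beta> \<notin> set ys \<Longrightarrow> sum_list (map (L(\<beta> := w)) ys) = sum_list (map L ys)"
  by (intro arg_cong[where f = sum_list] map_cong) auto

text \<open>As long as the last bottom letter \<open>\<beta>\<close> wins, the letters behind
  \<open>\<beta>\<close> in the top row rotate: each step brings the last one to the front. The
  induction runs from the end of \<open>y2\<close> because its last letter loses first.\<close>

lemma fold_astep_rotate:
  assumes "\<beta> \<notin> set t1" "\<beta> \<notin> set y2"
  shows "fold astep (replicate (length y2) (Suc 0)) (t1 @ \<beta> # y1 @ y2, b0 @ [\<beta>], L) =
    (t1 @ \<beta> # y2 @ y1, b0 @ [\<beta>], L(\<beta> := L \<beta> - sum_list (map L y2)))"
  using assms(2)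
proof (induction y2 arbitrary: y1 L rule: rev_induct)
  case Nil
  then show ?case by simp
next
  case (snoc y y2)
  let ?L = "L(\<beta> := L \<beta> - L y)"
  have s: "sum_list (map ?L y2) = sum_list (map L y2)"
    using snoc.prems by (intro sum_list_upd_notin) auto
  have "fold astep (replicate (length (y2 @ [y])) (Suc 0)) (t1 @ \<beta> # y1 @ y2 @ [y], b0 @ [\<beta>], L) =
     fold astep (replicate (length y2) (Suc 0)) (t1 @ \<beta> # (y # y1) @ y2, b0 @ [\<beta>], ?L)"
    using astep_1[OF assms(1), of "y1 @ y2" y b0 L] by simp
  also have "\<dots> = (t1 @ \<beta> # y2 @ (y # y1), b0 @ [\<beta>], ?L(\<beta> := ?L \<beta> - sum_list (map ?L y2)))"
    using snoc.prems by (intro snoc.IH) auto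
  finally show ?case unfolding s by (simp add: algebra_simps fun_eq_iff)
qed

text \<open>Whole turns restore the row, and each takes the full sum from the winner. This is the
  final run of ones in \<open>gamma\<close>, with winner 1.\<close>

lemma fold_astep_full_rotate:
  assumes "\<beta> \<notin> set y"
  shows "fold astep (replicate (c * length y) (Suc 0)) (\<beta> # y, b0 @ [\<beta>], L) =
    (\<beta> # y, b0 @ [\<beta>], L(\<beta> := L \<beta> - real c * sum_list (map L y)))"
proof (induction c arbitrary: L)
  case (Suc c)
  let ?L = "L(\<beta> := L \<beta> - sum_list (map L y))"
  have "fold astep (replicate (Suc c * length y) (Suc 0)) (\<beta> # y, b0 @ [\<beta>], L) =
    fold astep (replicate (c * length y) (Suc 0)) (\<beta> # y, b0 @ [\<beta>], ?L)"
    using fold_astep_rotate[of \<beta> "[]" y "[]" b0 L] assms by (simp add: replicate_add)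
  also have "\<dots> = (\<beta> # y, b0 @ [\<beta>], ?L(\<beta> := ?L \<beta> - real c * sum_list (map ?L y)))"
    by (rule Suc.IH)
  finally show ?case
    unfolding sum_list_upd_notin[OF assms] by (simp add: algebra_simps fun_eq_iff)
qed simp

text \<open>If the loser already stands right behind the winner in the bottom row, reinserting it
  changes nothing, so the step repeats as a subtraction.\<close>

lemma fold_astep_swap:
  assumes "\<alpha> \<noteq> \<beta>" "\<alpha> \<notin> set b1"
  shows "fold astep (replicate a 0) (t0 @ [\<alpha>], b1 @ [\<alpha>, \<beta>], L) =
    (t0 @ [\<alpha>], b1 @ [\<alpha>, \<beta>], L(\<alpha> := L \<alpha> - real a * L \<beta>))"
proof (induction a arbitrary: L)
  case (Suc a)
  then show ?case
    using astep_0[OF assms(2), of t0 "[]" \<beta> L] assms(1) by (simp add: algebra_simps fun_eq_iff)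
qed simp

text \<open>The ones bring \<open>m'\<close> to the end of the top row; the \<open>a\<close> zeros
  let \<open>m'\<close> beat \<open>m\<close>; the single one lets \<open>m\<close> beat
  \<open>m'\<close> and restores the top row; the last two zeros let \<open>e\<close> beat
  \<open>m\<close> and \<open>m'\<close>, which moves this pair behind \<open>e\<close> in the
  bottom row.\<close>

lemma fold_astep_gdot:
  assumes len: "n - 1 - m = length r + 1" and d: "distinct (t1 @ m # m' # r @ [e])"
    and bs: "{m, m', e} \<inter> set bs = {}"
  obtains L' where
    "fold astep (gdot n m a) (t1 @ m # m' # r @ [e], e # bs @ [m', m], L) =
       (t1 @ m # m' # r @ [e], e # m' # m # bs, L')"
    "L m = 2 * L' m + 2 * L' m' + sum_list (map L' r) + L' e"
    "L m' = real a * L' m + (real a + 1) * L' m'"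
    "L e = L' e + L' m + L' m'"
    "\<And>q. q \<notin> {m, m', e} \<Longrightarrow> L q = L' q"
proof -
  \<comment> \<open>One function for each stretch of the word: the run of ones, the run of zeros,
    the single one, and the two last zeros.\<close>
  define L1 where "L1 = L(m := L m - sum_list (map L (r @ [e])))"
  define L2 where "L2 = L1(m' := L1 m' - real a * L1 m)"
  define L3 where "L3 = L2(m := L2 m - L2 m')"
  define L4 where "L4 = L3(e := L3 e - L3 m)"
  define L5 where "L5 = L4(e := L4 e - L4 m')"
  have dist: "m \<noteq> m'" "m \<noteq> e" "m' \<noteq> e" "m \<notin> set r" "m' \<notin> set r" "e \<notin> set r" "m \<notin> set t1"
    using d by auto
  have 1: "fold astep (replicate (n - 1 - m) (Suc 0)) (t1 @ m # m' # r @ [e], e # bs @ [m', m], L) =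
      (t1 @ m # r @ [e, m'], e # bs @ [m', m], L1)"
    using fold_astep_rotate[of m t1 "r @ [e]" "[m']" "e # bs @ [m']" L] dist len
    unfolding L1_def by simp
  have 2: "fold astep (replicate a 0) (t1 @ m # r @ [e, m'], e # bs @ [m', m], L1) =
      (t1 @ m # r @ [e, m'], e # bs @ [m', m], L2)"
    using fold_astep_swap[of m' m "e # bs" a "t1 @ m # r @ [e]" L1] dist bs
    unfolding L2_def by simp
  have 3: "astep (Suc 0) (t1 @ m # r @ [e, m'], e # bs @ [m', m], L2) =
      (t1 @ m # m' # r @ [e], e # bs @ [m', m], L3)"
    using astep_1[of m t1 "r @ [e]" m' "e # bs @ [m']" L2] dist unfolding L3_def by simp
  have 4: "astep 0 (t1 @ m # m' # r @ [e], e # bs @ [m', m], L3) =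
      (t1 @ m # m' # r @ [e], e # m # bs @ [m'], L4)"
    using astep_0[of e "[]" "t1 @ m # m' # r" "bs @ [m']" m L3] unfolding L4_def by simp
  have 5: "astep 0 (t1 @ m # m' # r @ [e], e # m # bs @ [m'], L4) =
      (t1 @ m # m' # r @ [e], e # m' # m # bs, L5)"
    using astep_0[of e "[]" "t1 @ m # m' # r" "m # bs" m' L4] unfolding L5_def by simp
  have F: "fold astep (gdot n m a) (t1 @ m # m' # r @ [e], e # bs @ [m', m], L) =
       (t1 @ m # m' # r @ [e], e # m' # m # bs, L5)"
    unfolding gdot_def One_nat_def[symmetric] fold_append comp_apply
    using 1 2 3 4 5 by simp
  have other: "L q = L5 q" if "q \<notin> {m, m', e}" for q
    using that unfolding L5_def L4_def L3_def L2_def L1_def by simp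
  have "sum_list (map L5 r) = sum_list (map L r)"
    using dist by (intro arg_cong[where f = sum_list] map_cong refl other[symmetric]) auto
  then have "L m = 2 * L5 m + 2 * L5 m' + sum_list (map L5 r) + L5 e"
    using dist unfolding L5_def L4_def L3_def L2_def L1_def by simp
  moreover have "L m' = real a * L5 m + (real a + 1) * L5 m'"
    using dist unfolding L5_def L4_def L3_def L2_def L1_def by (simp add: algebra_simps)
  moreover have "L e = L5 e + L5 m + L5 m'"
    using dist unfolding L5_def L4_def L3_def L2_def L1_def by (simp add: algebra_simps)
  ultimately show ?thesis using that F other by blast
qed

abbreviation pairs :: "nat \<Rightarrow> nat \<Rightarrow> nat list" where
  "pairs i j \<equiv> concat (map (\<lambda>q. [2 * q + 1, 2 * q]) [i..<j])"

lemma set_pairs: "x \<in> set (pairs i j) \<Longrightarrow> 2 * i \<le> x \<and> x < 2 * j"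
  by auto

text \<open>The pairs are treated from the largest letters downwards. In the bottom row the treated
  pairs stand between \<open>n\<close> and 1, the others behind 1; once all are treated, the row is
  \<open>bot_row n\<close> again.\<close>

lemma fold_astep_gdots:
  assumes n: "n = 2 * h + 2" and jh: "j \<le> h"
  shows "\<exists>L'. fold astep (concat (map (\<lambda>i. gdot n (n - 2 * i) a) [1..<j + 1]))
        (top_row n, n # 1 # pairs 1 (h + 1), L) =
      (top_row n, n # pairs (h - j + 1) (h + 1) @ 1 # pairs 1 (h - j + 1), L') \<and>
    (\<forall>q\<in>{h - j<..h}. L (2 * q) = L' (2 * q) + L' (2 * q + 1) + (\<Sum>r=2 * (h - j) + 2..n. L' r) \<and>
       L (2 * q + 1) = real a * L' (2 * q) + (real a + 1) * L' (2 * q + 1)) \<and>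
    L n = (\<Sum>r=2 * (h - j) + 2..n. L' r) \<and> (\<forall>r\<le>2 * (h - j) + 1. L r = L' r)"
  using jh
proof (induction j)
  case 0
  then show ?case using n by (intro exI[of _ L]) auto
next
  case (Suc j)
  then have "j \<le> h" by simp
  from Suc.IH[OF this] obtain K where fK: "fold astep (concat (map (\<lambda>i. gdot n (n - 2 * i) a) [1..<j + 1]))
        (top_row n, n # 1 # pairs 1 (h + 1), L) =
      (top_row n, n # pairs (h - j + 1) (h + 1) @ 1 # pairs 1 (h - j + 1), K)"
    and K12: "\<forall>q\<in>{h - j<..h}. L (2 * q) = K (2 * q) + K (2 * q + 1) + (\<Sum>r=2 * (h - j) + 2..n. K r) \<and>
       L (2 * q + 1) = real a * K (2 * q) + (real a + 1) * K (2 * q + 1)"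
    and K3: "L n = (\<Sum>r=2 * (h - j) + 2..n. K r)" and K4: "\<forall>r\<le>2 * (h - j) + 1. L r = K r"
    by (elim exE conjE) (rule that)
  note K1 = K12[rule_format, THEN conjunct1] and K2 = K12[rule_format, THEN conjunct2] and K4 = K4[rule_format]
  \<comment> \<open>\<open>g\<close> names the truncated difference, so that \<open>m\<close> is the
    even letter of the pair treated next.\<close>
  define g where "g = h - Suc j"
  have g: "h - j = Suc g" "j = h - Suc g" "g < h" using Suc.prems by (auto simp: g_def)
  define m where "m = 2 * g + 2"
  have m: "n - 2 * Suc j = m" "m + 1 < n" "2 * (h - j) = m" "2 * Suc g = m" using g n by (auto simp: m_def)
  let ?bs = "pairs (h - j + 1) (h + 1) @ 1 # pairs 1 (g + 1)"
  have top: "top_row n = [1..<m] @ m # (m + 1) # [m + 2..<n] @ [n]"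
  proof -
    have "1 \<le> m" "m + (n - m) = n" "1 \<le> n" using m(2) by (simp_all add: m_def)
    then have "[1..<n] = [1..<m] @ [m..<n]" "[1..<n + 1] = [1..<n] @ [n]"
      by (metis upt_add_eq_append, metis Suc_eq_plus1 upt_Suc_append)
    then have "top_row n = [1..<m] @ [m..<n] @ [n]" unfolding top_row_def by simp
    also have "[m..<n] = m # (m + 1) # [m + 2..<n]" using m by (simp add: upt_conv_Cons)
    finally show ?thesis by simp
  qed
  have bot: "n # pairs (h - j + 1) (h + 1) @ 1 # pairs 1 (h - j + 1) = n # ?bs @ [m + 1, m]"
    unfolding g(1) m_def by simp
  have pr: "pairs (h - Suc j + 1) (h + 1) = (m + 1) # m # pairs (h - j + 1) (h + 1)"
  proof -
    have "[Suc g..<h + 1] = Suc g # [Suc (Suc g)..<h + 1]" using g(3) by (intro upt_conv_Cons) simp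
    then show ?thesis unfolding g(1) g_def[symmetric] m_def by (simp del: upt_Suc)
  qed
  have bs: "{m, m + 1, n} \<inter> set ?bs = {}"
  proof -
    have "x \<noteq> m \<and> x \<noteq> m + 1 \<and> x \<noteq> n" if "x \<in> set ?bs" for x
    proof -
      consider "x \<in> set (pairs (h - j + 1) (h + 1))" | "x = 1" | "x \<in> set (pairs 1 (g + 1))"
        using \<open>x \<in> set ?bs\<close> unfolding set_append set_simps(2) by blast
      then show ?thesis
      proof cases
        case 1
        then show ?thesis using set_pairs[OF 1] g(1) n by (simp add: m_def)
      next
        case 2
        then show ?thesis using n g(3) by (simp add: m_def)
      next
        case 3
        then show ?thesis using set_pairs[OF 3] g(3) n by (simp add: m_def)
      qed
    qed
    then show ?thesis by blast
  qed
  have dist: "distinct ([1..<m] @ m # (m + 1) # [m + 2..<n] @ [n])" using m(2) by auto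
  have len: "n - 1 - m = length [m + 2..<n] + 1" using m(2) by simp
  obtain L' where fL: "fold astep (gdot n m a) ([1..<m] @ m # (m + 1) # [m + 2..<n] @ [n], n # ?bs @ [m + 1, m], K) =
       ([1..<m] @ m # (m + 1) # [m + 2..<n] @ [n], n # (m + 1) # m # ?bs, L')"
    and L1: "K m = 2 * L' m + 2 * L' (m + 1) + sum_list (map L' [m + 2..<n]) + L' n"
    and L2: "K (m + 1) = real a * L' m + (real a + 1) * L' (m + 1)"
    and L3: "K n = L' n + L' m + L' (m + 1)"
    and L4: "\<And>q. q \<notin> {m, m + 1, n} \<Longrightarrow> K q = L' q"
    by (rule fold_astep_gdot[OF len dist bs, where a = a and L = K]) (rule that)
  have "fold astep (concat (map (\<lambda>i. gdot n (n - 2 * i) a) [1..<Suc j + 1]))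
        (top_row n, n # 1 # pairs 1 (h + 1), L) =
      (top_row n, n # pairs (h - Suc j + 1) (h + 1) @ 1 # pairs 1 (h - Suc j + 1), L')"
  proof -
    have "fold astep (concat (map (\<lambda>i. gdot n (n - 2 * i) a) [1..<Suc j + 1]))
        (top_row n, n # 1 # pairs 1 (h + 1), L) =
      fold astep (gdot n m a) (top_row n, n # pairs (h - j + 1) (h + 1) @ 1 # pairs 1 (h - j + 1), K)"
    proof -
      have "[1..<Suc j + 1] = [1..<j + 1] @ [Suc j]" by simp
      then have "concat (map (\<lambda>i. gdot n (n - 2 * i) a) [1..<Suc j + 1]) =
          concat (map (\<lambda>i. gdot n (n - 2 * i) a) [1..<j + 1]) @ gdot n m a"
        by (simp only: map_append concat_append list.map concat.simps append_Nil2 m(1))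
      then show ?thesis by (simp only: fold_append comp_apply fK)
    qed
    also have "\<dots> = (top_row n, n # (m + 1) # m # ?bs, L')"
      unfolding bot unfolding top by (rule fL)
    also have "n # (m + 1) # m # ?bs = n # pairs (h - Suc j + 1) (h + 1) @ 1 # pairs 1 (h - Suc j + 1)"
      by (simp only: pr append_Cons g_def)
    finally show ?thesis .
  qed
  moreover have split: "(\<Sum>r=m..n. L' r) = L' m + L' (m + 1) + (\<Sum>r=m + 2..<n. L' r) + L' n"
  proof -
    have "(\<Sum>r=m..n. L' r) = L' n + (\<Sum>r=m..<n. L' r)" using m(2) by (intro sum.last_plus) simp
    also have "(\<Sum>r=m..<n. L' r) = L' m + (\<Sum>r=Suc m..<n. L' r)"
      using m(2) by (intro sum.atLeast_Suc_lessThan) simp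
    also have "(\<Sum>r=Suc m..<n. L' r) = L' (Suc m) + (\<Sum>r=Suc (Suc m)..<n. L' r)"
      using m(2) by (intro sum.atLeast_Suc_lessThan) simp
    finally show ?thesis by simp
  qed
  \<comment> \<open>Among the letters above \<open>m + 1\<close> this part of the path changes only
    \<open>n\<close>, which gives up \<open>L' m + L' (m + 1)\<close>. The sum therefore just
    acquires the two new letters, and the formulas of the pairs treated earlier keep their
    form.\<close>
  have S: "(\<Sum>r=m + 2..n. K r) = (\<Sum>r=m..n. L' r)"
  proof -
    have "(\<Sum>r=m + 2..n. K r) = K n + (\<Sum>r=m + 2..<n. K r)" using m(2) by (intro sum.last_plus) simp
    also have "(\<Sum>r=m + 2..<n. K r) = (\<Sum>r=m + 2..<n. L' r)"
      using L4 by (intro sum.cong) auto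
    finally show ?thesis using split L3 by simp
  qed
  have ix: "2 * (h - Suc j) + 2 = m" "2 * (h - Suc j) + 1 < m" by (simp_all only: g_def[symmetric] m_def)
  have "L (2 * q) = L' (2 * q) + L' (2 * q + 1) + (\<Sum>r=2 * (h - Suc j) + 2..n. L' r) \<and>
       L (2 * q + 1) = real a * L' (2 * q) + (real a + 1) * L' (2 * q + 1)" if q: "q \<in> {h - Suc j<..h}" for q
  proof (cases "q = Suc g")
    case True
    have q2: "2 * q = m" using True by (simp add: m_def)
    have "sum_list (map L' [m + 2..<n]) = (\<Sum>r=m + 2..<n. L' r)" by (simp add: interv_sum_list_conv_sum_set_nat)
    then have "K m = L' m + L' (m + 1) + (\<Sum>r=m..n. L' r)"
      using L1 split by simp
    moreover have "L m = K m" "L (m + 1) = K (m + 1)" using K4 m(3) by simp_all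
    ultimately show ?thesis using L2 unfolding ix q2 by simp
  next
    case False
    then have "Suc g < q" "q \<le> h" using q unfolding g_def by auto
    then have q': "q \<in> {h - j<..h}" unfolding g(1) by simp
    have "2 * q \<notin> {m, m + 1, n}" "2 * q + 1 \<notin> {m, m + 1, n}"
      using \<open>Suc g < q\<close> \<open>q \<le> h\<close> n unfolding m_def by auto
    then have "K (2 * q) = L' (2 * q)" "K (2 * q + 1) = L' (2 * q + 1)" using L4 by blast+
    then show ?thesis using K1[OF q'] K2[OF q'] S unfolding ix m(3) by simp
  qed
  moreover have "L n = (\<Sum>r=2 * (h - Suc j) + 2..n. L' r)"
    using K3 S unfolding ix m(3) by simp
  moreover have "L r = L' r" if "r \<le> 2 * (h - Suc j) + 1" for r
  proof -
    have "r < m" using that ix(2) by linarith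
    then show ?thesis using K4[of r] L4[of r] m(2,3) by simp
  qed
  ultimately show ?case by blast
qed

text \<open>The equations are the rows of \<open>Theta\<close>, written with the sum over the
  columns 2 to \<open>n\<close> split off. As \<open>L\<close> is arbitrary, they apply to the
  measures of the intervals.\<close>

lemma fold_astep_gamma:
  assumes n: "n = 2 * h + 2"
  shows "\<exists>L'. fold astep (gamma n a c) (top_row n, bot_row n, L) = (top_row n, bot_row n, L') \<and>
     L 1 = L' 1 + real c * (\<Sum>r=2..n. L' r) \<and> L n = L' 1 + (real c + 1) * (\<Sum>r=2..n. L' r) \<and>
     (\<forall>q\<in>{1..h}. L (2 * q) = L' (2 * q) + L' (2 * q + 1) + (\<Sum>r=2..n. L' r) \<and>
       L (2 * q + 1) = real a * L' (2 * q) + (real a + 1) * L' (2 * q + 1))"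
proof -
  have h: "(n - 2) div 2 = h" using n by simp
  let ?K = "L(n := L n - L 1)"
  have 1: "astep 0 (top_row n, bot_row n, L) = (top_row n, n # 1 # pairs 1 (h + 1), ?K)"
    using astep_0[of n "[]" "[1..<n]" "pairs 1 (h + 1)" 1 L] n
    unfolding bot_row_def top_row_def h by simp
  obtain M where M: "fold astep (concat (map (\<lambda>i. gdot n (n - 2 * i) a) [1..<h + 1]))
        (top_row n, n # 1 # pairs 1 (h + 1), ?K) =
      (top_row n, n # pairs (h - h + 1) (h + 1) @ 1 # pairs 1 (h - h + 1), M)"
    and M1: "\<forall>q\<in>{h - h<..h}. ?K (2 * q) = M (2 * q) + M (2 * q + 1) + (\<Sum>r=2 * (h - h) + 2..n. M r) \<and>
       ?K (2 * q + 1) = real a * M (2 * q) + (real a + 1) * M (2 * q + 1)"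
    and M2: "?K n = (\<Sum>r=2 * (h - h) + 2..n. M r)" and M3: "\<forall>r\<le>2 * (h - h) + 1. ?K r = M r"
    using fold_astep_gdots[OF n order_refl, of a ?K] by blast
  let ?L = "M(1 := M 1 - real c * sum_list (map M [2..<n + 1]))"
  have top: "top_row n = 1 # [2..<n + 1]" "length [2..<n + 1] = n - 1"
    unfolding top_row_def using n upt_conv_Cons[of 1 "n + 1"] by (simp_all add: numeral_2_eq_2 del: upt_Suc)
  have "fold astep (replicate (c * length [2..<n + 1]) (Suc 0)) (1 # [2..<n + 1], (n # pairs 1 (h + 1)) @ [1], M) =
    (1 # [2..<n + 1], (n # pairs 1 (h + 1)) @ [1], ?L)"
    by (rule fold_astep_full_rotate) simp
  then have 2: "fold astep (replicate (c * (n - 1)) (Suc 0)) (top_row n, bot_row n, M) = (top_row n, bot_row n, ?L)"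
    unfolding top bot_row_def h by simp
  have bot: "n # pairs (h - h + 1) (h + 1) @ 1 # pairs 1 (h - h + 1) = bot_row n"
    unfolding bot_row_def h by simp
  have F: "fold astep (gamma n a c) (top_row n, bot_row n, L) = (top_row n, bot_row n, ?L)"
    unfolding gamma_def h fold_append comp_apply using 1 M 2 bot by (simp del: upt_Suc)
  have s: "sum_list (map M [2..<n + 1]) = (\<Sum>r=2..n. M r)"
    by (simp add: interv_sum_list_conv_sum_set_nat atLeastLessThanSuc_atLeastAtMost del: upt_Suc)
  have s': "(\<Sum>r=2..n. ?L r) = (\<Sum>r=2..n. M r)" by (intro sum.cong) auto
  \<comment> \<open>The initial zero of \<open>gamma\<close> subtracts the entry 1 from the entry
    \<open>n\<close>; this is why row \<open>n\<close> of \<open>Theta\<close> exceeds row 1 by one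
    in the columns from 2 on.\<close>
  have M2': "L n - L 1 = (\<Sum>r=2..n. M r)"
    using M2 by (simp only: fun_upd_same diff_self_eq_0 mult_0_right add_0)
  have "L 1 = M 1" using M3[rule_format, of 1] n by simp
  then have "L 1 = ?L 1 + real c * (\<Sum>r=2..n. ?L r)" "L n = ?L 1 + (real c + 1) * (\<Sum>r=2..n. ?L r)"
    using M2' unfolding s' s by (simp_all add: algebra_simps)
  moreover have "L (2 * q) = ?L (2 * q) + ?L (2 * q + 1) + (\<Sum>r=2..n. ?L r) \<and>
       L (2 * q + 1) = real a * ?L (2 * q) + (real a + 1) * ?L (2 * q + 1)" if "q \<in> {1..h}" for q
  proof -
    have "2 * q \<noteq> n" "2 * q + 1 \<noteq> n" "2 * q \<noteq> 1" "2 * q + 1 \<noteq> 1" "q \<in> {h - h<..h}"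
      using that n by auto
    then show ?thesis using M1[rule_format, of q] unfolding s' diff_self_eq_0 mult_0_right add_0
      by (simp del: One_nat_def)
  qed
  ultimately show ?thesis using F by blast
qed

section \<open>Dimension with respect to a measure\<close>

lemma d_nu_bounds:
  assumes "prob_space \<nu>"
  shows "0 \<le> d_nu \<nu> x y" "d_nu \<nu> x y \<le> 1"
  using prob_space.prob_le_1[OF assms] by (auto simp: d_nu_def)

lemma d_nu_le_pdiam:
  assumes "prob_space \<nu>" "x \<in> U" "y \<in> U"
  shows "d_nu \<nu> x y \<le> pdiam (d_nu \<nu>) U"
proof -
  have "d_nu \<nu> x y \<le> Sup {d_nu \<nu> x y | x y. x \<in> U \<and> y \<in> U}"
    using assms(2,3) d_nu_bounds[OF assms(1)]
    by (intro cSup_upper bdd_aboveI[of _ 1]) blast+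
  then show ?thesis using assms(2) by (auto simp: pdiam_def)
qed

lemma pdiam_le:
  assumes "U \<noteq> {}" "\<And>x y. x \<in> U \<Longrightarrow> y \<in> U \<Longrightarrow> d x y \<le> e"
  shows "pdiam d U \<le> e"
proof -
  have "{d x y | x y. x \<in> U \<and> y \<in> U} \<noteq> {}" using assms(1) by blast
  then have "Sup {d x y | x y. x \<in> U \<and> y \<in> U} \<le> e" using assms(2) by (intro cSup_least) auto
  then show ?thesis using assms(1) by (simp add: pdiam_def)
qed

text \<open>For points of \<open>{0..<1}\<close> the distance is the difference of the values of
  \<open>G\<close>. Cutting the range of \<open>G\<close> into steps of length 1 / N gives a cover
  with content at most \<open>(N + 1) * (1 / N) powr s\<close>, which tends to 0 as s > 1.\<close>

lemma hmeasure_d_nu_eq_0: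
  fixes \<nu> :: "real measure"
  assumes \<nu>: "prob_space \<nu>" "sets \<nu> = sets borel" and s: "1 < s"
  shows "hmeasure s (d_nu \<nu>) {0..<1} = 0"
proof -
  interpret prob_space \<nu> by fact
  define G where "G x = measure \<nu> {0..<x}" for x
  have G01: "0 \<le> G x" "G x \<le> 1" for x by (auto simp: G_def)
  have dG: "d_nu \<nu> x y = \<bar>G x - G y\<bar>" if "x \<in> {0..<1}" "y \<in> {0..<1}" for x y
  proof -
    have *: "measure \<nu> {x..<y} = G y - G x" if "0 \<le> x" "x \<le> y" for x y
      using measure_Ico_split[OF \<nu>, of 0 x y] that by (simp add: G_def)
    have "0 \<le> measure \<nu> {x..<y}" "0 \<le> measure \<nu> {y..<x}" by simp_all
    then show ?thesis
      using *[of x y] *[of y x] that by (cases "x \<le> y") (auto simp: d_nu_def min_def max_def simp del: measure_nonneg)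
  qed
  have "hcontent s \<delta> (d_nu \<nu>) {0..<1} = 0" if \<delta>: "0 < \<delta>" for \<delta>
  proof -
    have bound: "hcontent s \<delta> (d_nu \<nu>) {0..<1} \<le> ennreal ((real N + 1) * (1 / real N) powr s)"
      if N: "1 / \<delta> < real N" for N
    proof -
      have N0: "0 < real N" using N \<delta> by (meson divide_pos_pos less_trans zero_less_one)
      have N\<delta>: "1 / real N \<le> \<delta>" using N N0 \<delta> by (simp add: field_simps)
      define U where "U q = {x \<in> {0..<1}. nat \<lfloor>G x * real N\<rfloor> = q}" for q
      have small: "d_nu \<nu> x y \<le> 1 / real N" if "x \<in> U q" "y \<in> U q" for x y q
      proof -
        have "0 \<le> G x * real N" "0 \<le> G y * real N" using G01 N0 by simp_all
        then have "real q \<le> G x * real N" "G x * real N < real q + 1" "real q \<le> G y * real N" "G y * real N < real q + 1"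
          using that unfolding U_def by simp_all linarith+
        then have "\<bar>G x * real N - G y * real N\<bar> \<le> 1" by linarith
        then have "\<bar>G x - G y\<bar> * real N \<le> 1" using N0 by (simp add: left_diff_distrib[symmetric] abs_mult)
        then show ?thesis using dG[of x y] that N0 unfolding U_def by (simp add: field_simps)
      qed
      have empty: "U q = {}" if "N < q" for q
      proof -
        have "nat \<lfloor>G x * real N\<rfloor> \<le> N" for x
        proof -
          have "G x * real N \<le> real N" using G01[of x] N0 by (simp add: mult_left_le_one_le)
          then show ?thesis by linarith
        qed
        then have "nat \<lfloor>G x * real N\<rfloor> \<noteq> q" for x using that by (metis not_le)
        then show ?thesis unfolding U_def by simp
      qed
      have hterm_U: "hterm s (d_nu \<nu>) (U q) \<le> ennreal ((1 / real N) powr s)" for q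
      proof (cases "U q = {}")
        case False
        then have "pdiam (d_nu \<nu>) (U q) \<le> 1 / real N" by (intro pdiam_le small)
        moreover obtain x where x: "x \<in> U q" using False by blast
        have "0 \<le> pdiam (d_nu \<nu>) (U q)"
          by (rule order_trans[OF d_nu_bounds(1)[OF \<nu>(1)] d_nu_le_pdiam[OF \<nu>(1) x x]])
        ultimately show ?thesis using s False by (auto simp: hterm_def intro!: ennreal_leI powr_mono2)
      qed (simp add: hterm_def)
      have "hcontent s \<delta> (d_nu \<nu>) {0..<1} \<le> (\<Sum>q. hterm s (d_nu \<nu>) (U q))"
        unfolding hcontent_def
      proof (rule INF_lower)
        have "{0..<1} \<subseteq> (\<Union>q. U q)" unfolding U_def by auto
        moreover have "d_nu \<nu> x y \<le> \<delta>" if "x \<in> U q" "y \<in> U q" for x y q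
          using small[OF that] N\<delta> by linarith
        ultimately show "U \<in> {U. {0..<1} \<subseteq> \<Union> (range U) \<and> (\<forall>i. \<forall>x\<in>U i. \<forall>y\<in>U i. d_nu \<nu> x y \<le> \<delta>)}"
          by blast
      qed
      also have "\<dots> = (\<Sum>q\<in>{..N}. hterm s (d_nu \<nu>) (U q))"
        using empty by (intro suminf_finite) (auto simp: hterm_def)
      also have "\<dots> \<le> (\<Sum>q\<in>{..N}. ennreal ((1 / real N) powr s))" by (intro sum_mono hterm_U)
      also have "\<dots> = ennreal ((real N + 1) * (1 / real N) powr s)"
        by (simp add: ennreal_mult[symmetric] ennreal_of_nat_eq_real_of_nat add.commute del: of_nat_Suc)
      finally show ?thesis .
    qed
    have "(\<lambda>N. (real N + 1) * (1 / real N) powr s) \<longlonglongrightarrow> 0"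
      using s by real_asymp
    then have "(\<lambda>N. ennreal ((real N + 1) * (1 / real N) powr s)) \<longlonglongrightarrow> ennreal 0"
      by (rule tendsto_ennrealI)
    moreover have "eventually (\<lambda>N. hcontent s \<delta> (d_nu \<nu>) {0..<1} \<le> ennreal ((real N + 1) * (1 / real N) powr s)) sequentially"
    proof -
      have "eventually (\<lambda>N. 1 / \<delta> < real N) sequentially"
        using filterlim_real_sequentially by (simp add: filterlim_at_top_dense)
      then show ?thesis by (rule eventually_mono) (rule bound)
    qed
    ultimately have "hcontent s \<delta> (d_nu \<nu>) {0..<1} \<le> ennreal 0"
      by (intro tendsto_lowerbound) auto
    then show ?thesis by simp
  qed
  then show ?thesis unfolding hmeasure_def by (auto intro!: SUP_eq_const)
qed

lemma dimH_measure_le_1: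
  assumes "prob_space \<nu>" "sets \<nu> = sets borel" "emeasure \<mu> {0..<1} = 1"
  shows "dimH_measure \<mu> (d_nu \<nu>) \<le> 1"
proof -
  have "dimH_measure \<mu> (d_nu \<nu>) \<le> hdim (d_nu \<nu>) {0..<1}"
    unfolding dimH_measure_def using assms(3) by (intro Inf_lower) auto
  also have "\<dots> \<le> 1"
  proof (rule dense_ge)
    fix z :: ereal assume z: "1 < z"
    show "hdim (d_nu \<nu>) {0..<1} \<le> z"
    proof (cases z)
      case (real s)
      then have "1 < s" using z by simp
      then show ?thesis
        unfolding hdim_def real using hmeasure_d_nu_eq_0[OF assms(1,2)] by (intro Inf_lower) auto
    qed (use z in auto)
  qed
  finally show ?thesis .
qed

text \<open>Only intervals with endpoints in \<open>U\<close> can be compared with the diameter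
  of \<open>U\<close>, so the convex hull is exhausted by such intervals; its endpoints carry no mass.\<close>
lemma emeasure_le_hterm:
  fixes \<mu> \<nu> :: "real measure"
  assumes \<mu>: "prob_space \<mu>" "sets \<mu> = sets borel" and \<nu>: "prob_space \<nu>"
    and atom: "\<And>x. measure \<mu> {x} = 0"
    and s: "0 \<le> s" and C: "1 \<le> C"
    and frost: "\<And>x y. \<lbrakk>0 \<le> x; x < y; y \<le> 1; 0 < s\<rbrakk> \<Longrightarrow> measure \<mu> {x..<y} \<le> C * measure \<nu> {x..<y} powr s"
    and V: "V \<subseteq> {0..<1}" "V \<noteq> {}" "V \<subseteq> U"
  shows "emeasure \<mu> {Inf V..Sup V} \<le> ennreal C * hterm s (d_nu \<nu>) U"
proof (cases "s = 0")
  case True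
  \<comment> \<open>For exponent 0 every nonempty set has weight 1 by convention, which a
    probability and \<open>1 \<le> C\<close> suffice to handle.\<close>
  have "emeasure \<mu> {Inf V..Sup V} \<le> 1" using prob_space.emeasure_le_1[OF \<mu>(1)] .
  then have "emeasure \<mu> {Inf V..Sup V} \<le> ennreal C" using C by (meson ennreal_ge_1 order_trans)
  moreover have "U \<noteq> {}" using V by blast
  ultimately show ?thesis using True by (simp add: hterm_def)
next
  case False
  interpret prob_space \<mu> by fact
  let ?D = "pdiam (d_nu \<nu>) U"
  define m where "m = Inf V"
  define M where "M = Sup V"
  have bdd: "bdd_below V" "bdd_above V"
    using V(1) by (auto intro!: bdd_belowI[of _ 0] bdd_aboveI[of _ 1])
  have bnd: "measure \<mu> {m + 1 / (real k + 1)..<M - 1 / (real k + 1)} \<le> C * ?D powr s" for k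
  proof (cases "m + 1 / (real k + 1) < M - 1 / (real k + 1)")
    case True
    have e: "0 < 1 / (real k + 1)" by simp
    obtain x where x: "x \<in> V" "x < m + 1 / (real k + 1)"
      using cInf_lessD[OF V(2), of "m + 1 / (real k + 1)"] e unfolding m_def by auto
    obtain y where y: "y \<in> V" "M - 1 / (real k + 1) < y"
      using less_cSupD[OF V(2), of "M - 1 / (real k + 1)"] e unfolding M_def by auto
    have xy: "x < y" using x y True by linarith
    have "measure \<mu> {m + 1 / (real k + 1)..<M - 1 / (real k + 1)} \<le> measure \<mu> {x..<y}"
      using x y \<mu>(2) by (intro finite_measure_mono) auto
    also have "\<dots> \<le> C * measure \<nu> {x..<y} powr s"
      using x(1) y(1) V(1) xy s False by (intro frost) auto
    also have "measure \<nu> {x..<y} = d_nu \<nu> x y" using xy by (simp add: d_nu_def min_def max_def)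
    also have "C * d_nu \<nu> x y powr s \<le> C * ?D powr s"
      using C s x(1) y(1) V(3) d_nu_bounds(1)[OF \<nu>]
      by (intro mult_left_mono powr_mono2 d_nu_le_pdiam[OF \<nu>]) auto
    finally show ?thesis .
  next
    case False
    then have "{m + 1 / (real k + 1)..<M - 1 / (real k + 1)} = {}" by simp
    then show ?thesis using C by simp
  qed
  define E where "E k = {m + 1 / (real k + 1)..<M - 1 / (real k + 1)}" for k
  have E_sets: "E k \<in> sets \<mu>" for k using \<mu>(2) by (simp add: E_def)
  then have UE: "(\<Union>k. E k) \<in> sets \<mu>" by blast
  have "E k \<subseteq> E (Suc k)" for k
  proof -
    have "1 / (real (Suc k) + 1) \<le> 1 / (real k + 1)" by (intro divide_left_mono) auto
    moreover have "{m + e..<M - e} \<subseteq> {m + e'..<M - e'}" if "e' \<le> e" for e e' :: real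
      using that by auto
    ultimately show ?thesis unfolding E_def by blast
  qed
  then have "incseq E" by (simp add: incseq_Suc_iff)
  then have "(\<lambda>k. measure \<mu> (E k)) \<longlonglongrightarrow> measure \<mu> (\<Union>k. E k)"
    using E_sets by (intro finite_Lim_measure_incseq) auto
  then have le: "measure \<mu> (\<Union>k. E k) \<le> C * ?D powr s"
    by (rule LIMSEQ_le_const2) (use bnd in \<open>simp add: E_def\<close>)
  have "{m..M} \<subseteq> {m} \<union> {M} \<union> (\<Union>k. E k)"
  proof
    fix z assume z: "z \<in> {m..M}"
    show "z \<in> {m} \<union> {M} \<union> (\<Union>k. E k)"
    proof (cases "z = m \<or> z = M")
      case False
      then have "0 < min (z - m) (M - z)" using z by auto
      then obtain k where "inverse (real (Suc k)) < min (z - m) (M - z)" using reals_Archimedean by blast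
      then have "1 / (real k + 1) < z - m" "1 / (real k + 1) < M - z" by (simp_all add: inverse_eq_divide add.commute)
      then have "z \<in> E k" unfolding E_def by simp
      then show ?thesis by blast
    qed auto
  qed
  then have "measure \<mu> {m..M} \<le> measure \<mu> ({m} \<union> {M} \<union> (\<Union>k. E k))"
    using \<mu>(2) UE by (intro finite_measure_mono) auto
  also have "\<dots> \<le> measure \<mu> ({m} \<union> {M}) + measure \<mu> (\<Union>k. E k)"
    using \<mu>(2) UE by (intro measure_Un_le) auto
  also have "measure \<mu> ({m} \<union> {M}) \<le> measure \<mu> {m} + measure \<mu> {M}"
    using \<mu>(2) by (intro measure_Un_le) auto
  finally have "measure \<mu> {m..M} \<le> C * ?D powr s" using atom le by simp
  then have "emeasure \<mu> {m..M} \<le> ennreal (C * ?D powr s)"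
    by (simp add: emeasure_eq_measure ennreal_leI)
  also have "ennreal (C * ?D powr s) = ennreal C * hterm s (d_nu \<nu>) U"
  proof -
    have "U \<noteq> {}" using V by blast
    then show ?thesis using False C by (simp add: hterm_def ennreal_mult)
  qed
  finally show ?thesis by (simp add: m_def M_def)
qed

lemma dimH_measure_ge_1:
  fixes \<mu> \<nu> :: "real measure"
  assumes \<mu>: "prob_space \<mu>" "sets \<mu> = sets borel" and \<nu>: "prob_space \<nu>"
    and atom: "\<And>x. measure \<mu> {x} = 0"
    and frost: "\<And>s. \<lbrakk>0 < s; s < 1\<rbrakk> \<Longrightarrow>
      \<exists>C\<ge>1. \<forall>x y. 0 \<le> x \<longrightarrow> x < y \<longrightarrow> y \<le> 1 \<longrightarrow> measure \<mu> {x..<y} \<le> C * measure \<nu> {x..<y} powr s"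
  shows "1 \<le> dimH_measure \<mu> (d_nu \<nu>)"
proof -
  have "hmeasure s (d_nu \<nu>) A \<noteq> 0"
    if A: "A \<in> sets borel" "A \<subseteq> {0..<1}" "emeasure \<mu> A = 1" and s: "0 \<le> s" "s < 1" for A s
  proof -
    obtain C where C: "1 \<le> C"
      and fr: "\<And>x y. \<lbrakk>0 \<le> x; x < y; y \<le> 1; 0 < s\<rbrakk> \<Longrightarrow> measure \<mu> {x..<y} \<le> C * measure \<nu> {x..<y} powr s"
    proof (cases "0 < s")
      case True
      from frost[OF this s(2)] show ?thesis using that by blast
    next
      case False
      then show ?thesis using that[of 1] by simp
    qed
    \<comment> \<open>A bound at the single scale 1 is enough, as \<open>hmeasure\<close> is a
      supremum over the scales.\<close>
    have "ennreal (1 / C) \<le> hcontent s 1 (d_nu \<nu>) A"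
      unfolding hcontent_def
    proof (rule INF_greatest)
      fix U assume "U \<in> {U :: nat \<Rightarrow> real set. A \<subseteq> (\<Union>i. U i) \<and> (\<forall>i. \<forall>x\<in>U i. \<forall>y\<in>U i. d_nu \<nu> x y \<le> 1)}"
      then have U: "A \<subseteq> (\<Union>i. U i)" by blast
      \<comment> \<open>The members of a cover may be non-measurable. Their traces on
        \<open>A\<close> are replaced by closed intervals, which are measurable and have bounded
        ends because \<open>A\<close> lies in \<open>{0..<1}\<close>.\<close>
      define J where "J i = (if U i \<inter> A = {} then {} else {Inf (U i \<inter> A)..Sup (U i \<inter> A)})" for i
      have Js: "J i \<in> sets \<mu>" for i using \<mu>(2) by (simp add: J_def)
      have sub: "U i \<inter> A \<subseteq> J i" for i
      proof
        fix x assume x: "x \<in> U i \<inter> A"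
        have "U i \<inter> A \<subseteq> {0..1}" using A(2) by force
        then have "bdd_below (U i \<inter> A)" "bdd_above (U i \<inter> A)"
          by (meson bdd_below_mono bdd_below_Icc, meson bdd_above_mono bdd_above_Icc)
        then have "Inf (U i \<inter> A) \<le> x" "x \<le> Sup (U i \<inter> A)" using cInf_lower[OF x] cSup_upper[OF x] by blast+
        then show "x \<in> J i" using x unfolding J_def by (simp only: atLeastAtMost_iff if_split) blast
      qed
      have AJ: "A \<subseteq> (\<Union>i. J i)"
      proof
        fix x assume "x \<in> A"
        then obtain i where "x \<in> U i" using U by auto
        then show "x \<in> (\<Union>i. J i)" using sub[of i] \<open>x \<in> A\<close> by auto
      qed
      have t: "emeasure \<mu> (J i) \<le> ennreal C * hterm s (d_nu \<nu>) (U i)" for i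
      proof (cases "U i \<inter> A = {}")
        case False
        have "emeasure \<mu> {Inf (U i \<inter> A)..Sup (U i \<inter> A)} \<le> ennreal C * hterm s (d_nu \<nu>) (U i)"
        proof (rule emeasure_le_hterm[OF \<mu> \<nu> atom s(1) C])
          show "U i \<inter> A \<subseteq> {0..<1}" using A(2) by blast
        qed (fact fr False Int_lower1)+
        then show ?thesis using False by (simp add: J_def)
      qed (simp add: J_def)
      have "emeasure \<mu> A \<le> emeasure \<mu> (\<Union>i. J i)"
        using AJ Js by (intro emeasure_mono) blast+
      then have "1 \<le> emeasure \<mu> (\<Union>i. J i)" using A(3) by simp
      also have "\<dots> \<le> (\<Sum>i. emeasure \<mu> (J i))" using Js by (intro emeasure_subadditive_countably) auto
      also have "\<dots> \<le> (\<Sum>i. ennreal C * hterm s (d_nu \<nu>) (U i))" using t by (intro suminf_le) auto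
      also have "\<dots> = ennreal C * (\<Sum>i. hterm s (d_nu \<nu>) (U i))" by simp
      finally have "ennreal (1 / C) * 1 \<le> ennreal (1 / C) * (ennreal C * (\<Sum>i. hterm s (d_nu \<nu>) (U i)))"
        by (rule mult_left_mono) simp
      also have "\<dots> = (\<Sum>i. hterm s (d_nu \<nu>) (U i))"
        using C by (simp add: mult.assoc[symmetric] ennreal_mult[symmetric])
      finally show "ennreal (1 / C) \<le> (\<Sum>i. hterm s (d_nu \<nu>) (U i))" by simp
    qed
    also have "\<dots> \<le> hmeasure s (d_nu \<nu>) A" unfolding hmeasure_def by (intro SUP_upper) simp
    finally have "ennreal (1 / C) \<le> hmeasure s (d_nu \<nu>) A" .
    moreover have "0 < ennreal (1 / C)" using C by simp
    ultimately show ?thesis by (metis leD)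
  qed
  then have "1 \<le> hdim (d_nu \<nu>) A" if "A \<in> sets borel" "A \<subseteq> {0..<1}" "emeasure \<mu> A = 1" for A
    unfolding hdim_def using that by (intro Inf_greatest) (force simp: not_less[symmetric])
  then show ?thesis unfolding dimH_measure_def by (intro Inf_greatest) blast
qed

section \<open>Length estimates\<close>

text \<open>For the first claim: the letters 1 and \<open>n\<close> see the whole total of the next
  level, an even letter sees \<open>n\<close> and so needs two levels, an odd letter sees its even
  partner and needs three. The first two claims serve the lower bound of \<open>Lm_bounds\<close>;
  the second, third and fourth serve its upper bound.\<close>

lemma length_recursion_bounds:
  fixes L :: "nat \<Rightarrow> nat \<Rightarrow> real" and A C :: "nat \<Rightarrow> real"
  assumes n: "n = 2 * h + 2" "1 \<le> h"
    and nonneg: "\<And>k r. 0 \<le> L k r" and C: "\<And>k. 1 \<le> C k" and A: "\<And>k. C k \<le> A k"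
    and R1: "\<And>k. L k 1 = L (Suc k) 1 + C k * (\<Sum>r=2..n. L (Suc k) r)"
    and Rn: "\<And>k. L k n = L (Suc k) 1 + (C k + 1) * (\<Sum>r=2..n. L (Suc k) r)"
    and Re: "\<And>k q. q \<in> {1..h} \<Longrightarrow> L k (2 * q) = L (Suc k) (2 * q) + L (Suc k) (2 * q + 1) + (\<Sum>r=2..n. L (Suc k) r)"
    and Ro: "\<And>k q. q \<in> {1..h} \<Longrightarrow> L k (2 * q + 1) = A k * L (Suc k) (2 * q) + (A k + 1) * L (Suc k) (2 * q + 1)"
  defines "S \<equiv> \<lambda>k. \<Sum>r=1..n. L k r"
  shows "\<And>k r. r \<in> {1..n} \<Longrightarrow> S (k + 3) \<le> L k r"
    and "\<And>k. S k \<le> real n * (A k + 1) * S (Suc k)"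
    and "\<And>k. S (Suc k) \<le> L k n"
    and "\<And>k. C k * L (Suc k) n \<le> L k n"
proof -
  define W where "W k = (\<Sum>r=2..n. L k r)" for k
  have W: "0 \<le> W k" for k unfolding W_def using nonneg by (intro sum_nonneg) auto
  have SW: "S k = L k 1 + W k" for k
  proof -
    have "{1..n} = insert 1 {2..n}" using n by auto
    then show ?thesis by (simp add: S_def W_def)
  qed
  have Lk_W: "L k r \<le> W k" if "r \<in> {2..n}" for k r
    unfolding W_def using nonneg that by (intro member_le_sum) auto
  have A1: "1 \<le> A k" for k using A[of k] C[of k] by linarith
  have CW: "W k \<le> C j * W k" for j k using mult_right_mono[OF C W, of k j] by simp
  have cases_r: "r = 1 \<or> r = n \<or> (\<exists>q\<in>{1..h}. r = 2 * q \<or> r = 2 * q + 1)" if "r \<in> {1..n}" for r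
  proof -
    have "r = 2 * (r div 2) \<or> r = 2 * (r div 2) + 1" by presburger
    moreover have "r div 2 \<in> {1..h} \<or> r = 1 \<or> r = n" using that n by auto
    ultimately show ?thesis by blast
  qed
  have b1: "S (Suc k) \<le> L k 1" for k
    using R1[of k] CW[of "Suc k" k] unfolding SW W_def[symmetric] by linarith
  show bn: "S (Suc k) \<le> L k n" for k
    using Rn[of k] CW[of "Suc k" k] W[of "Suc k"] unfolding SW W_def[symmetric] by (simp add: algebra_simps)
  have dec: "S (Suc k) \<le> S k" for k using b1[of k] W[of k] unfolding SW[of k] by linarith
  have be: "S (k + 2) \<le> L k (2 * q)" if "q \<in> {1..h}" for k q
  proof -
    have "S (k + 2) \<le> L (Suc k) n" using bn[of "Suc k"] by simp
    also have "\<dots> \<le> W (Suc k)" using n by (intro Lk_W) auto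
    also have "\<dots> \<le> L k (2 * q)" using Re[OF that, of k] nonneg unfolding W_def by simp
    finally show ?thesis .
  qed
  have bo: "S (k + 3) \<le> L k (2 * q + 1)" if "q \<in> {1..h}" for k q
  proof -
    have "S (k + 3) \<le> L (Suc k) (2 * q)" using be[OF that, of "Suc k"] by (simp add: numeral_3_eq_3)
    also have "\<dots> \<le> A k * L (Suc k) (2 * q)" using mult_right_mono[OF A1 nonneg] by simp
    also have "\<dots> \<le> L k (2 * q + 1)" using Ro[OF that, of k] nonneg A1[of k] by simp
    finally show ?thesis .
  qed
  have dec3: "S (k + 3) \<le> S (k + 2)" "S (k + 2) \<le> S (Suc k)" for k
    using dec[of "Suc (Suc k)"] dec[of "Suc k"] by (simp_all add: numeral_3_eq_3)
  show "S (k + 3) \<le> L k r" if "r \<in> {1..n}" for k r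
    using cases_r[OF that] b1[of k] bn[of k] be[of _ k] bo[of _ k] dec3[of k] by force
  \<comment> \<open>Every coefficient of the recursion is at most \<open>A k + 1\<close>; the
    coefficient 2 in the even rows is covered by \<open>1 \<le> A k\<close>.\<close>
  have up: "L k r \<le> (A k + 1) * S (Suc k)" if r: "r \<in> {1..n}" for k r
  proof -
    let ?x = "L (Suc k) 1" and ?W = "W (Suc k)"
    have x: "0 \<le> ?x" "0 \<le> ?W" using nonneg W by auto
    have ax: "?x \<le> (A k + 1) * ?x" using mult_right_mono[of 1 "A k + 1", OF _ x(1)] A1[of k] by simp
    have cw: "(C k + 1) * ?W \<le> (A k + 1) * ?W" using A[of k] x by (intro mult_right_mono) auto
    have c1: "C k * ?W \<le> (C k + 1) * ?W" using x by (intro mult_right_mono) auto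
    have w2: "2 * ?W \<le> (A k + 1) * ?W" using A1[of k] x by (intro mult_right_mono) auto
    have ax0: "0 \<le> (A k + 1) * ?x" using x A1[of k] by simp
    have dist: "(A k + 1) * S (Suc k) = (A k + 1) * ?x + (A k + 1) * ?W" unfolding SW by (simp add: algebra_simps)
    have two: "L (Suc k) (2 * q) + L (Suc k) (2 * q + 1) \<le> ?W" if "q \<in> {1..h}" for q
    proof -
      have "(\<Sum>r\<in>{2 * q, 2 * q + 1}. L (Suc k) r) \<le> (\<Sum>r=2..n. L (Suc k) r)"
        using that n nonneg by (intro sum_mono2) auto
      then show ?thesis unfolding W_def by simp
    qed
    consider "r = 1" | "r = n" | q where "q \<in> {1..h}" "r = 2 * q" | q where "q \<in> {1..h}" "r = 2 * q + 1"
      using cases_r[OF r] by blast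
    then show ?thesis
    proof cases
      case 1
      show ?thesis unfolding 1 using R1[of k] ax cw c1 dist unfolding W_def[symmetric] by linarith
    next
      case 2
      show ?thesis unfolding 2 using Rn[of k] ax cw dist unfolding W_def[symmetric] by linarith
    next
      case 3
      show ?thesis unfolding 3(2) using Re[OF 3(1), of k] two[OF 3(1)] w2 ax0 dist unfolding W_def[symmetric] by linarith
    next
      case 4
      have "L k r \<le> (A k + 1) * (L (Suc k) (2 * q) + L (Suc k) (2 * q + 1))"
        using Ro[OF 4(1), of k] 4(2) nonneg[of "Suc k" "2 * q"] by (simp add: algebra_simps)
      also have "\<dots> \<le> (A k + 1) * ?W" using two[OF 4(1)] A1[of k] by (intro mult_left_mono) auto
      finally show ?thesis using ax0 dist by linarith
    qed
  qed
  show "S k \<le> real n * (A k + 1) * S (Suc k)" for k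
  proof -
    have "(\<Sum>r=1..n. L k r) \<le> (\<Sum>r=1..n. (A k + 1) * S (Suc k))" by (intro sum_mono up)
    moreover have "S k = (\<Sum>r=1..n. L k r)" by (simp add: S_def)
    ultimately show ?thesis by (simp add: mult.assoc)
  qed
  show "C k * L (Suc k) n \<le> L k n" for k
  proof -
    have "C k * L (Suc k) n \<le> C k * W (Suc k)" using Lk_W[of n "Suc k"] C[of k] n by (intro mult_left_mono) auto
    then show ?thesis
      using Rn[of k] nonneg[of "Suc k" 1] W[of "Suc k"] unfolding W_def[symmetric] by (simp add: algebra_simps)
  qed
qed

text \<open>Applied with P = ln p and Q = ln K. The expressions compared are \<open>hfun k\<close>,
  \<open>lfun k\<close> and, with k + 4, \<open>lfun (Suc k)\<close>; apart from the factor
  \<open>s\<close>, all have leading term k^2 P.\<close>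

lemma quadratic_asymptotics:
  fixes P Q s :: real
  assumes "0 < P"
  shows "filterlim (\<lambda>k. (real k)\<^sup>2 * P - (3 * real k + 1) * P - Q) at_top sequentially"
    and "(\<lambda>k. ((real k + 3) * Q + (real k + 3)\<^sup>2 * P) / ((real k)\<^sup>2 * P - (3 * real k + 1) * P - Q)) \<longlonglongrightarrow> 1"
    and "(\<lambda>k. ((real k)\<^sup>2 - real k) * P / ((real k + 3) * Q + (real k + 3)\<^sup>2 * P)) \<longlonglongrightarrow> 1"
    and "(\<lambda>k. (s * ((real k + 4) * Q + (real k + 4)\<^sup>2 * P) + ln 2) / ((real k)\<^sup>2 * P - (3 * real k + 1) * P - Q)) \<longlonglongrightarrow> s"
  using assms by real_asymp+

text \<open>The measures enter as a set, to obtain one system of floors for all of them. A member of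
  \<open>Ms\<close> is also what \<open>st_step\<close> uses to see that the rows return after each
  block.\<close>

locale iet_setup =
  fixes n p :: nat and a c :: "nat \<Rightarrow> nat" and l :: "nat \<Rightarrow> real" and Ms :: "real measure set"
  assumes n_even: "even n" and n_ge: "4 \<le> n" and p_ge: "n + 1 \<le> p" and c_pos: "0 < c 1"
    and c_rec: "\<forall>k\<ge>1. c (Suc k) = p\<^sup>2 * c k" and a_def: "\<forall>k\<ge>1. a k = p * c k"
    and l_pos: "\<forall>r\<in>{1..n}. 0 < l r" and l_sum: "(\<Sum>r=1..n. l r) = 1"
    and path: "has_rauzy_path n a c l"
    and Ms_ne: "Ms \<noteq> {}"
    and Ms: "\<And>M. M \<in> Ms \<Longrightarrow> sets M = sets borel \<and> prob_space M \<and> emeasure M {0..<1} = 1 \<and>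
       distr M borel (iet_map (top_row n) (bot_row n) l) = M"
begin

section \<open>Rauzy states and measures at the ends of the blocks\<close>

definition "h = (n - 2) div 2"

lemma n_eq: "n = 2 * h + 2" "1 \<le> h"
  using n_even n_ge by (auto simp: h_def)

lemma c_eq: "c (Suc k) = c 1 * p ^ (2 * k)"
proof (induction k)
  case (Suc k)
  have "c (Suc (Suc k)) = p\<^sup>2 * c (Suc k)" using c_rec by simp
  then show ?case using Suc by (simp add: power2_eq_square)
qed simp

lemma a_eq: "a (Suc k) = c 1 * p ^ (2 * k + 1)"
  using a_def c_eq[of k] by simp

definition "st k = rauzy_iter n l (block_start n a c k)"
definition "lk k = snd (snd (st k))"
definition "Lm \<mu> k = mlen \<mu> (top_row n) (lk k)"

lemma Ms': "\<forall>\<mu>\<in>Ms. prob_space \<mu> \<and> sets \<mu> = sets borel"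
  using Ms by blast

lemma rauzy_iter_add: "rauzy_iter n l (m + r) = (rauzy_step ^^ r) (rauzy_iter n l m)"
  unfolding rauzy_iter_def by (subst add.commute) (simp add: funpow_add)

lemma st_Suc: "st (Suc k) = (rauzy_step ^^ length (gamma n (a (Suc k)) (c (Suc k)))) (st k)"
  by (simp add: st_def block_start_def rauzy_iter_add)

lemma st_path:
  "r < length (gamma n (a (Suc k)) (c (Suc k))) \<Longrightarrow>
     rauzy_type ((rauzy_step ^^ r) (st k)) = Some (gamma n (a (Suc k)) (c (Suc k)) ! r)"
  using path unfolding has_rauzy_path_def st_def rauzy_iter_add by simp

text \<open>The lengths force the types listed in \<open>gamma\<close>, so the state with lengths
  replaced by measures runs through \<open>fold_astep_gamma\<close>, which returns to the initial
  rows.\<close>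

lemma st_step:
  assumes "good_state Ms (st k)" "st k = (top_row n, bot_row n, lk k)"
  shows "good_state Ms (st (Suc k))" "st (Suc k) = (top_row n, bot_row n, lk (Suc k))"
    and "\<And>\<mu>. \<mu> \<in> Ms \<Longrightarrow>
      Lm \<mu> k 1 = Lm \<mu> (Suc k) 1 + real (c (Suc k)) * (\<Sum>r=2..n. Lm \<mu> (Suc k) r) \<and>
      Lm \<mu> k n = Lm \<mu> (Suc k) 1 + (real (c (Suc k)) + 1) * (\<Sum>r=2..n. Lm \<mu> (Suc k) r) \<and>
     (\<forall>q\<in>{1..h}. Lm \<mu> k (2 * q) = Lm \<mu> (Suc k) (2 * q) + Lm \<mu> (Suc k) (2 * q + 1) + (\<Sum>r=2..n. Lm \<mu> (Suc k) r) \<and>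
       Lm \<mu> k (2 * q + 1) = real (a (Suc k)) * Lm \<mu> (Suc k) (2 * q) + (real (a (Suc k)) + 1) * Lm \<mu> (Suc k) (2 * q + 1))"
proof -
  note P = good_rauzy_path[OF assms(1) st_path Ms', folded st_Suc]
  show "good_state Ms (st (Suc k))" using P by blast
  have ms: "mstate \<mu> (st k) = (top_row n, bot_row n, Lm \<mu> k)" for \<mu>
    unfolding assms(2) by (simp add: mstate_def Lm_def)
  have F: "\<exists>L'. mstate \<mu> (st (Suc k)) = (top_row n, bot_row n, L') \<and>
     Lm \<mu> k 1 = L' 1 + real (c (Suc k)) * (\<Sum>r=2..n. L' r) \<and> Lm \<mu> k n = L' 1 + (real (c (Suc k)) + 1) * (\<Sum>r=2..n. L' r) \<and>
     (\<forall>q\<in>{1..h}. Lm \<mu> k (2 * q) = L' (2 * q) + L' (2 * q + 1) + (\<Sum>r=2..n. L' r) \<and>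
       Lm \<mu> k (2 * q + 1) = real (a (Suc k)) * L' (2 * q) + (real (a (Suc k)) + 1) * L' (2 * q + 1))" if "\<mu> \<in> Ms" for \<mu>
  proof -
    have "mstate \<mu> (st (Suc k)) = fold astep (gamma n (a (Suc k)) (c (Suc k))) (top_row n, bot_row n, Lm \<mu> k)"
      using P that ms by simp
    then show ?thesis using fold_astep_gamma[OF n_eq(1), of "a (Suc k)" "c (Suc k)" "Lm \<mu> k"] by simp
  qed
  \<comment> \<open>The rows of \<open>mstate\<close> do not depend on the measure, so any one
    member tells that they have returned.\<close>
  obtain \<mu>0 where "\<mu>0 \<in> Ms" using Ms_ne by blast
  from F[OF this] obtain L0 where "mstate \<mu>0 (st (Suc k)) = (top_row n, bot_row n, L0)" by blast
  then show eq: "st (Suc k) = (top_row n, bot_row n, lk (Suc k))"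
    by (cases "st (Suc k)") (simp add: mstate_def lk_def)
  fix \<mu> assume "\<mu> \<in> Ms"
  from F[OF this] obtain L' where L': "mstate \<mu> (st (Suc k)) = (top_row n, bot_row n, L')"
     "Lm \<mu> k 1 = L' 1 + real (c (Suc k)) * (\<Sum>r=2..n. L' r) \<and> Lm \<mu> k n = L' 1 + (real (c (Suc k)) + 1) * (\<Sum>r=2..n. L' r) \<and>
     (\<forall>q\<in>{1..h}. Lm \<mu> k (2 * q) = L' (2 * q) + L' (2 * q + 1) + (\<Sum>r=2..n. L' r) \<and>
       Lm \<mu> k (2 * q + 1) = real (a (Suc k)) * L' (2 * q) + (real (a (Suc k)) + 1) * L' (2 * q + 1))" by blast
  have "L' = Lm \<mu> (Suc k)" using L'(1) unfolding eq by (simp add: mstate_def Lm_def)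
  then show "Lm \<mu> k 1 = Lm \<mu> (Suc k) 1 + real (c (Suc k)) * (\<Sum>r=2..n. Lm \<mu> (Suc k) r) \<and>
      Lm \<mu> k n = Lm \<mu> (Suc k) 1 + (real (c (Suc k)) + 1) * (\<Sum>r=2..n. Lm \<mu> (Suc k) r) \<and>
     (\<forall>q\<in>{1..h}. Lm \<mu> k (2 * q) = Lm \<mu> (Suc k) (2 * q) + Lm \<mu> (Suc k) (2 * q + 1) + (\<Sum>r=2..n. Lm \<mu> (Suc k) r) \<and>
       Lm \<mu> k (2 * q + 1) = real (a (Suc k)) * Lm \<mu> (Suc k) (2 * q) + (real (a (Suc k)) + 1) * Lm \<mu> (Suc k) (2 * q + 1))"
    using L'(2) by simp
qed

lemma st_good: "good_state Ms (st k) \<and> st k = (top_row n, bot_row n, lk k)"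
proof (induction k)
  case 0
  have "st 0 = (top_row n, bot_row n, l)" by (simp add: st_def block_start_def rauzy_iter_def)
  then show ?case using good_initial[OF n_even n_ge l_pos l_sum Ms] by (simp add: lk_def)
next
  case (Suc k)
  then show ?case using st_step[of k] by blast
qed

lemma Ik_eq: "r \<in> {1..n} \<Longrightarrow> measure \<mu> (Ik n a c l k r) = Lm \<mu> k r"
proof -
  assume r: "r \<in> {1..n}"
  have "rauzy_iter n l (block_start n a c k) = (top_row n, bot_row n, lk k)"
    using st_good[of k] by (simp add: st_def)
  then show ?thesis
    using r rows(1)[OF n_even n_ge] by (simp add: Ik_def Lm_def mlen_def)
qed

lemma floors: "\<exists>F. floor_family Ms (top_row n) (lk k) F"
proof -
  have "good_state Ms (top_row n, bot_row n, lk k)" using st_good[of k] by metis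
  then show ?thesis unfolding good_state_def by simp
qed

lemma lk_pos: "\<forall>x\<in>set (top_row n). 0 < lk k x"
proof -
  have "good_state Ms (top_row n, bot_row n, lk k)" using st_good[of k] by metis
  then show ?thesis unfolding good_state_def by simp
qed

text \<open>\<open>K\<close> absorbs n (A + 1) \<le> 2 n A with A =
  \<open>c 1 * p ^ (2 * k + 1)\<close>. In \<open>lo\<close>, k + 3 factors
  \<open>K * p ^ (2 * j + 1)\<close> are multiplied, the odd exponents summing to a square. In
  \<open>hi\<close>, one such factor at level k meets the bound
  \<open>p ^ k / p ^ (k\<^sup>2)\<close> for the interval \<open>n\<close>.\<close>

definition "K = 2 * real n * real (c 1)"
definition "lo k = 1 / (K ^ (k + 3) * real p ^ ((k + 3)\<^sup>2))"
definition "hi k = K * real p ^ (3 * k + 1) / real p ^ (k\<^sup>2)"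

lemma K_ge: "1 \<le> K" and p_gt: "1 < real p"
proof -
  have "1 \<le> n * c 1" using n_ge c_pos by simp
  then have "1 \<le> real n * real (c 1)" by (metis of_nat_1 of_nat_le_iff of_nat_mult)
  then show "1 \<le> K" unfolding K_def by linarith
  show "1 < real p" using p_ge n_ge by simp
qed

lemma Lm_bounds:
  assumes \<mu>: "\<mu> \<in> Ms" and r: "r \<in> {1..n}"
  shows "lo k \<le> Lm \<mu> k r" "Lm \<mu> k r \<le> hi k"
proof -
  interpret prob_space \<mu> using Ms \<mu> by blast
  note R = st_step(3)[OF st_good[THEN conjunct1] st_good[THEN conjunct2] \<mu>]
  define C where "C k = real (c (Suc k))" for k
  define A where "A k = real (a (Suc k))" for k
  define S where "S k = (\<Sum>r=1..n. Lm \<mu> k r)" for k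
  have c1: "1 \<le> real (c 1)" using c_pos by simp
  have p1: "1 \<le> real p ^ m" for m using p_gt by simp
  have C_ge: "real p ^ (2 * k) \<le> C k" for k
    unfolding C_def c_eq[of k] using mult_right_mono[OF c1, of "real p ^ (2 * k)"] by simp
  have C1: "1 \<le> C k" for k using C_ge[of k] p1[of "2 * k"] by linarith
  have AC: "A k = real p * C k" for k
    unfolding A_def C_def using a_def by simp
  have CA: "C k \<le> A k" for k using AC[of k] mult_right_mono[of 1 "real p" "C k"] p_gt C1[of k] by simp
  have nonneg: "0 \<le> Lm \<mu> k r" for k r by (simp add: Lm_def mlen_def)
  have R1: "Lm \<mu> k 1 = Lm \<mu> (Suc k) 1 + C k * (\<Sum>r=2..n. Lm \<mu> (Suc k) r)"
    and Rn: "Lm \<mu> k n = Lm \<mu> (Suc k) 1 + (C k + 1) * (\<Sum>r=2..n. Lm \<mu> (Suc k) r)" for k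
    unfolding C_def using R[of k] by blast+
  have Re: "Lm \<mu> k (2 * q) = Lm \<mu> (Suc k) (2 * q) + Lm \<mu> (Suc k) (2 * q + 1) + (\<Sum>r=2..n. Lm \<mu> (Suc k) r)"
    and Ro: "Lm \<mu> k (2 * q + 1) = A k * Lm \<mu> (Suc k) (2 * q) + (A k + 1) * Lm \<mu> (Suc k) (2 * q + 1)"
    if "q \<in> {1..h}" for k q
    unfolding A_def using R[of k] that by blast+
  note B = length_recursion_bounds[where L = "Lm \<mu>" and C = C and A = A, OF n_eq nonneg C1 CA R1 Rn Re Ro,
      folded S_def]
  have B1: "S (k + 3) \<le> Lm \<mu> k r" if "r \<in> {1..n}" for k r
    by (rule B(1)[OF _ _ that])
  have B2: "S k \<le> real n * (A k + 1) * S (Suc k)" and B3: "S (Suc k) \<le> Lm \<mu> k n"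
    and B4: "C k * Lm \<mu> (Suc k) n \<le> Lm \<mu> k n" for k
    by (rule B(2), assumption+) (rule B(3), assumption+, rule B(4), assumption+)
  have S0: "0 \<le> S k" for k unfolding S_def using nonneg by (intro sum_nonneg) auto
  have B2': "S k \<le> K * real p ^ (2 * k + 1) * S (Suc k)" for k
  proof -
    have A1: "A k + 1 \<le> 2 * A k" using CA[of k] C1[of k] by linarith
    have "A k = real (c 1) * real p ^ (2 * k + 1)" unfolding A_def a_eq by simp
    then have "real n * (A k + 1) \<le> K * real p ^ (2 * k + 1)"
      unfolding K_def using mult_left_mono[OF A1, of "real n"] by (simp add: algebra_simps)
    then have "real n * (A k + 1) * S (Suc k) \<le> K * real p ^ (2 * k + 1) * S (Suc k)"
      by (rule mult_right_mono[OF _ S0])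
    then show ?thesis using B2[of k] by linarith
  qed
  \<comment> \<open>The intervals of level 0 cover the full measure set \<open>{0..<1}\<close>;
    subadditivity gives the inequality.\<close>
  have "1 \<le> S 0"
  proof -
    let ?I = "\<lambda>r. {left_end (top_row n) (lk 0) r..<left_end (top_row n) (lk 0) r + lk 0 r}"
    have l0: "lk 0 = l" by (simp add: lk_def st_def block_start_def rauzy_iter_def)
    note rw = rows[OF n_even n_ge]
    have cov: "{0..<1} \<subseteq> (\<Union>r\<in>{1..n}. ?I r)"
    proof
      fix z :: real assume "z \<in> {0..<1}"
      then obtain x where "x \<in> {1..n}" "left_end (top_row n) l x \<le> z" "z < left_end (top_row n) l x + l x"
        using left_end_cover[OF rw(2), of z l] rw(1) l_sum by auto
      then show "z \<in> (\<Union>r\<in>{1..n}. ?I r)" unfolding l0 by auto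
    qed
    have sb: "sets \<mu> = sets borel" "emeasure \<mu> {0..<1} = 1" using Ms \<mu> by blast+
    have "1 = measure \<mu> {0..<1}" using sb by (simp add: measure_def)
    also have "\<dots> \<le> measure \<mu> (\<Union>r\<in>{1..n}. ?I r)" using cov sb by (intro finite_measure_mono) auto
    also have "\<dots> \<le> (\<Sum>r\<in>{1..n}. measure \<mu> (?I r))" using sb by (intro measure_UNION_le) auto
    also have "\<dots> = S 0" unfolding S_def Lm_def mlen_def using rw(1) by simp
    finally show ?thesis .
  qed
  \<comment> \<open>The exponents grow by 2 k + 1, the difference of consecutive squares.\<close>
  have low: "1 \<le> S k * (K ^ k * real p ^ (k\<^sup>2))" for k
  proof (induction k)
    case (Suc k)
    have "1 \<le> S k * (K ^ k * real p ^ (k\<^sup>2))" by (rule Suc)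
    also have "\<dots> \<le> (K * real p ^ (2 * k + 1) * S (Suc k)) * (K ^ k * real p ^ (k\<^sup>2))"
      using B2' K_ge p_gt by (intro mult_right_mono) auto
    also have "\<dots> = S (Suc k) * (K ^ Suc k * (real p ^ (2 * k + 1) * real p ^ (k\<^sup>2)))" by simp
    also have "real p ^ (2 * k + 1) * real p ^ (k\<^sup>2) = real p ^ ((Suc k)\<^sup>2)"
    proof -
      have "2 * k + 1 + k\<^sup>2 = (Suc k)\<^sup>2" by (simp add: power2_eq_square)
      then show ?thesis by (simp only: power_add[symmetric])
    qed
    finally show ?case .
  qed (use \<open>1 \<le> S 0\<close> in simp)
  have Kp: "0 < K ^ m * real p ^ m'" for m m' using K_ge p_gt by simp
  have "lo k \<le> S (k + 3)"
    unfolding lo_def using low[of "k + 3"] Kp by (simp add: divide_le_eq)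
  then show "lo k \<le> Lm \<mu> k r" using B1[OF r, of k] by linarith
  \<comment> \<open>This is the decay by \<open>p ^ (2 * k)\<close> per block, with
    \<open>p ^ k\<close> on the other side to avoid the subtraction k^2 - k in an exponent.\<close>
  have up: "Lm \<mu> k n * real p ^ (k\<^sup>2) \<le> real p ^ k" for k
  proof (induction k)
    case 0
    then show ?case by (simp add: Lm_def mlen_def)
  next
    case (Suc k)
    have "Lm \<mu> (Suc k) n * real p ^ ((Suc k)\<^sup>2) = real p ^ (2 * k) * Lm \<mu> (Suc k) n * real p ^ (k\<^sup>2) * real p"
      by (simp add: power2_eq_square power_add algebra_simps power_mult)
    also have "\<dots> \<le> C k * Lm \<mu> (Suc k) n * real p ^ (k\<^sup>2) * real p"
      using C_ge nonneg by (intro mult_right_mono) auto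
    also have "\<dots> \<le> Lm \<mu> k n * real p ^ (k\<^sup>2) * real p"
      using B4 by (intro mult_right_mono) auto
    also have "\<dots> \<le> real p ^ k * real p" using Suc by (intro mult_right_mono) auto
    finally show ?case by (simp add: mult.commute)
  qed
  \<comment> \<open>Any interval is compared with the interval \<open>n\<close> of the same level
    through the total mass one level deeper.\<close>
  have "Lm \<mu> k r \<le> S k" unfolding S_def using nonneg r by (intro member_le_sum) auto
  also have "\<dots> \<le> K * real p ^ (2 * k + 1) * S (Suc k)" by (rule B2')
  also have "\<dots> \<le> K * real p ^ (2 * k + 1) * Lm \<mu> k n" using B3 K_ge by (intro mult_left_mono) auto
  also have "\<dots> \<le> K * real p ^ (2 * k + 1) * (real p ^ k / real p ^ (k\<^sup>2))"
    using up[of k] p_gt K_ge by (intro mult_left_mono) (auto simp: le_divide_eq)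
  also have "\<dots> = hi k" unfolding hi_def by (simp add: power_add[symmetric] algebra_simps)
  finally show "Lm \<mu> k r \<le> hi k" .
qed

text \<open>All matrices are nonnegative, so a diagonal entry of the product is at least the product
  of the diagonal entries. For a special index these are \<open>a + 1\<close> or
  \<open>c + 1\<close>, at least \<open>p ^ (2 * k)\<close> in block k + 1; for the other indices
  they are only 1 or 2.\<close>

lemma bki_ge:
  assumes "i \<in> special_idx n"
  shows "real p ^ (k\<^sup>2) \<le> bki n a c k i * real p ^ k"
proof -
  have i: "i \<in> {1..n}" "i \<noteq> 1" "i = n \<or> odd i"
    using assms n_eq by (auto simp: special_idx_def)
  have T0: "0 \<le> Theta n x y r s" for x y r s by (simp add: Theta_def)
  have P0: "0 \<le> theta_prod n a c 0 k r s" for k r s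
  proof (induction k arbitrary: r s)
    case (Suc k)
    then show ?case using T0 by (auto simp: mat_mult_def intro!: sum_nonneg)
  qed (simp add: mat_id_def)
  have T: "real p ^ (2 * k) \<le> Theta n (a (Suc k)) (c (Suc k)) i i" for k
  proof -
    have c1: "1 \<le> real (c 1)" using c_pos by simp
    have "real p ^ (2 * k) \<le> real (c (Suc k))"
      unfolding c_eq[of k] using mult_right_mono[OF c1, of "real p ^ (2 * k)"] by simp
    moreover have "c (Suc k) \<le> a (Suc k)" using a_def p_gt by simp
    then have "real (c (Suc k)) \<le> real (a (Suc k))" by simp
    moreover have "Theta n (a (Suc k)) (c (Suc k)) i i = real (c (Suc k)) + 1 \<or>
        Theta n (a (Suc k)) (c (Suc k)) i i = real (a (Suc k)) + 1"
      using i by (auto simp: Theta_def)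
    ultimately show ?thesis by linarith
  qed
  have "real p ^ (k\<^sup>2) \<le> theta_prod n a c 0 k i i * real p ^ k"
  proof (induction k)
    case (Suc k)
    let ?P = "theta_prod n a c 0 k" and ?T = "Theta n (a (Suc k)) (c (Suc k))"
    have "real p ^ ((Suc k)\<^sup>2) = real p ^ (k\<^sup>2) * real p ^ (2 * k) * real p"
      by (simp add: power2_eq_square power_add algebra_simps power_mult)
    also have "\<dots> \<le> (?P i i * real p ^ k) * ?T i i * real p"
      using Suc T P0 by (intro mult_right_mono mult_mono) auto
    also have "\<dots> = ?P i i * ?T i i * real p ^ Suc k" by simp
    also have "?P i i * ?T i i \<le> mat_mult n ?P ?T i i"
      unfolding mat_mult_def using i P0 T0 by (intro member_le_sum) auto
    finally show ?case by (simp add: mult_right_mono)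
  qed (simp add: mat_id_def)
  also have "theta_prod n a c 0 k i i \<le> bki n a c k i"
    unfolding bki_def using i P0 by (intro member_le_sum) auto
  finally show ?thesis by (simp add: mult_right_mono)
qed

text \<open>Minus the logarithms of \<open>lo k\<close> and \<open>hi k\<close>; the two agree up to
  O(k).\<close>

definition "lfun k = (real k + 3) * ln K + (real k + 3)\<^sup>2 * ln (real p)"
definition "hfun k = (real k)\<^sup>2 * ln (real p) - (3 * real k + 1) * ln (real p) - ln K"

lemma lo_pos: "0 < lo k" and hi_pos: "0 < hi k"
  using K_ge p_gt by (simp_all add: lo_def hi_def)

lemma ln_lo: "ln (lo k) = - lfun k"
proof -
  have "ln (lo k) = - (ln (K ^ (k + 3)) + ln (real p ^ ((k + 3)\<^sup>2)))"
    unfolding lo_def using K_ge p_gt by (simp add: ln_div ln_mult)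
  also have "\<dots> = - lfun k"
    using K_ge p_gt by (simp add: lfun_def ln_realpow)
  finally show ?thesis .
qed

lemma ln_hi: "ln (hi k) = - hfun k"
proof -
  have "ln (hi k) = ln K + ln (real p ^ (3 * k + 1)) - ln (real p ^ (k\<^sup>2))"
    unfolding hi_def using K_ge p_gt by (simp add: ln_div ln_mult)
  also have "\<dots> = - hfun k"
    using K_ge p_gt by (simp add: hfun_def ln_realpow del: power_Suc)
  finally show ?thesis .
qed

lemma lnp: "0 < ln (real p)"
  using p_gt by simp

lemma lfun_nonneg: "0 \<le> lfun k"
  unfolding lfun_def using lnp K_ge by simp

lemma hfun_at_top: "filterlim hfun at_top sequentially"
  unfolding hfun_def by (rule quadratic_asymptotics(1)[OF lnp])

lemma lfun_hfun: "(\<lambda>k. lfun k / hfun k) \<longlonglongrightarrow> 1"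
  unfolding lfun_def hfun_def by (rule quadratic_asymptotics(2)[OF lnp])

lemma hi_lim: "hi \<longlonglongrightarrow> 0"
proof -
  have "hi k = exp (- hfun k)" for k using exp_ln[OF hi_pos, of k] unfolding ln_hi by simp
  then have "hi = (\<lambda>k. exp (- hfun k))" by blast
  moreover have "filterlim (\<lambda>k. - hfun k) at_bot sequentially"
    using hfun_at_top by (simp add: filterlim_uminus_at_bot)
  ultimately show ?thesis by (simp add: filterlim_compose[OF exp_at_bot])
qed

text \<open>The next level changes the exponent only by O(k), while the power \<open>s\<close> gains
  (1 - s) k^2 ln p, which also absorbs the factor 2.\<close>

lemma hi_le_lo_powr:
  assumes "0 < s" "s < 1"
  shows "eventually (\<lambda>k. 2 * hi k \<le> lo (Suc k) powr s) sequentially"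
proof -
  have "lfun (Suc k) = (real k + 4) * ln K + (real k + 4)\<^sup>2 * ln (real p)" for k
    by (simp add: lfun_def algebra_simps)
  then have "(\<lambda>k. (s * lfun (Suc k) + ln 2) / hfun k) \<longlonglongrightarrow> s"
    unfolding hfun_def using quadratic_asymptotics(4)[OF lnp, of s "ln K"] by presburger
  then have "eventually (\<lambda>k. (s * lfun (Suc k) + ln 2) / hfun k < 1) sequentially"
    by (rule order_tendstoD(2)) fact
  moreover have "eventually (\<lambda>k. 0 < hfun k) sequentially"
    using hfun_at_top by (simp add: filterlim_at_top_dense)
  ultimately show ?thesis
  proof eventually_elim
    case (elim k)
    then have "ln 2 - hfun k \<le> - (s * lfun (Suc k))" by (simp add: divide_less_eq)
    then have "ln (2 * hi k) \<le> ln (lo (Suc k) powr s)"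
      using hi_pos[of k] lo_pos[of "Suc k"] by (simp add: ln_mult ln_hi ln_lo ln_powr)
    moreover have "0 < 2 * hi k" "0 < lo (Suc k) powr s" using hi_pos[of k] lo_pos[of "Suc k"] by simp_all
    ultimately show ?case by (meson ln_le_cancel_iff)
  qed
qed

text \<open>\<open>Q k\<close> stands for the interval containing a whole floor of level k. Only its
  two consequences are passed on; both refer to the same floors, although they concern different
  measures.\<close>

lemma floor_dichotomy:
  assumes \<mu>: "\<mu> \<in> Ms" and \<nu>: "\<nu> \<in> Ms" and xy: "0 \<le> x" "x < y" "y \<le> 1"
  obtains Q where "\<And>k. Q k \<Longrightarrow> lo k \<le> measure \<nu> {x..<y}"
    "\<And>k. \<not> Q k \<Longrightarrow> measure \<mu> {x..<y} \<le> 2 * hi k"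
proof -
  have "\<forall>k. \<exists>F. floor_family Ms (top_row n) (lk k) F" using floors by blast
  then obtain F where F: "\<And>k. floor_family Ms (top_row n) (lk k) (F k)" by metis
  have fm: "measure \<kappa> {w..<w + lk k z} = Lm \<kappa> k z \<and> z \<in> {1..n}" if "\<kappa> \<in> Ms" "(z, w) \<in> F k" for \<kappa> z w k
    using floor_measure[OF F that lk_pos] rows(1)[OF n_even n_ge] by (simp add: Lm_def)
  define Q where "Q k \<longleftrightarrow> (\<exists>(z, w)\<in>F k. x \<le> w \<and> w + lk k z \<le> y)" for k
  have "lo k \<le> measure \<nu> {x..<y}" if Qk: "Q k" for k
  proof -
    interpret prob_space \<nu> using Ms \<nu> by blast
    obtain z w where zw: "(z, w) \<in> F k" "x \<le> w" "w + lk k z \<le> y" using Qk unfolding Q_def by blast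
    have "lo k \<le> measure \<nu> {w..<w + lk k z}"
      using fm[OF \<nu> zw(1)] Lm_bounds(1)[OF \<nu>] by simp
    also have "\<dots> \<le> measure \<nu> {x..<y}"
      using zw Ms[OF \<nu>] by (intro finite_measure_mono) auto
    finally show ?thesis .
  qed
  moreover have "measure \<mu> {x..<y} \<le> 2 * hi k" if nQ: "\<not> Q k" for k
  proof -
    interpret prob_space \<mu> using Ms \<mu> by blast
    have "\<not> (x \<le> w \<and> w + lk k z \<le> y)" if "(z, w) \<in> F k" for z w
      using nQ that unfolding Q_def by blast
    from floor_family_Ico[OF F xy this] obtain z w z' w' where
      zw: "(z, w) \<in> F k" "(z', w') \<in> F k" "{x..<y} \<subseteq> {w..<w + lk k z} \<union> {w'..<w' + lk k z'}"
      by blast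
    have sb: "sets \<mu> = sets borel" using Ms[OF \<mu>] by blast
    have "measure \<mu> {x..<y} \<le> measure \<mu> ({w..<w + lk k z} \<union> {w'..<w' + lk k z'})"
      using zw(3) sb by (intro finite_measure_mono) auto
    also have "\<dots> \<le> measure \<mu> {w..<w + lk k z} + measure \<mu> {w'..<w' + lk k z'}"
      using sb by (intro measure_Un_le) auto
    also have "\<dots> \<le> hi k + hi k"
      using fm[OF \<mu> zw(1)] fm[OF \<mu> zw(2)] Lm_bounds(2)[OF \<mu>] by (intro add_mono) simp_all
    finally show ?thesis by simp
  qed
  ultimately show ?thesis using that by blast
qed

text \<open>Consecutive scales satisfy \<open>2 * hi k \<le> lo (k + 1) powr s\<close>, so it does not matter which floors of level
  \<open>k + 1\<close> the interval contains.\<close>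
lemma interval_measure_powr:
  assumes \<mu>: "\<mu> \<in> Ms" and \<nu>: "\<nu> \<in> Ms" and s: "0 < s" "s < 1"
  shows "\<exists>C\<ge>1. \<forall>x y. 0 \<le> x \<longrightarrow> x < y \<longrightarrow> y \<le> 1 \<longrightarrow> measure \<mu> {x..<y} \<le> C * measure \<nu> {x..<y} powr s"
proof -
  interpret prob_space \<mu> using Ms \<mu> by blast
  obtain k0 where k0: "\<And>k. k0 \<le> k \<Longrightarrow> 2 * hi k \<le> lo (Suc k) powr s"
    using hi_le_lo_powr[OF s] unfolding eventually_sequentially by blast
  \<comment> \<open>The second term serves the intervals that already contain a floor of level
    \<open>k0\<close>.\<close>
  define C where "C = max 1 (1 / lo k0 powr s)"
  have "measure \<mu> {x..<y} \<le> C * measure \<nu> {x..<y} powr s" if xy: "0 \<le> x" "x < y" "y \<le> 1" for x y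
  proof -
    obtain Q where Q: "\<And>k. Q k \<Longrightarrow> lo k \<le> measure \<nu> {x..<y}"
      and nQ: "\<And>k. \<not> Q k \<Longrightarrow> measure \<mu> {x..<y} \<le> 2 * hi k"
      using floor_dichotomy[OF \<mu> \<nu> xy] by metis
    have Qs: "lo k powr s \<le> measure \<nu> {x..<y} powr s" if "Q k" for k
      using Q[OF that] lo_pos[of k] s by (intro powr_mono2) auto
    have C1: "measure \<nu> {x..<y} powr s \<le> C * measure \<nu> {x..<y} powr s"
      using mult_right_mono[of 1 C "measure \<nu> {x..<y} powr s"] by (simp add: C_def)
    consider "Q k0" | "\<not> Q k0" "\<exists>k\<ge>k0. Q k" | "\<And>k. k0 \<le> k \<Longrightarrow> \<not> Q k" by blast
    then show ?thesis
    proof cases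
      case 1
      have "measure \<mu> {x..<y} \<le> 1" by simp
      also have "1 \<le> 1 / lo k0 powr s * measure \<nu> {x..<y} powr s"
        using Qs[OF 1] lo_pos[of k0] by (simp add: le_divide_eq)
      also have "\<dots> \<le> C * measure \<nu> {x..<y} powr s" by (intro mult_right_mono) (auto simp: C_def)
      finally show ?thesis .
    next
      case 2
      \<comment> \<open>At the least level where \<open>Q\<close> holds it fails one level earlier;
        this pairs the upper bound at \<open>j\<close> with the lower bound at
        \<open>Suc j\<close>.\<close>
      define k where "k = (LEAST k. k0 \<le> k \<and> Q k)"
      have k: "k0 \<le> k" "Q k" using LeastI_ex[of "\<lambda>k. k0 \<le> k \<and> Q k"] 2(2) unfolding k_def by blast+
      then have "k \<noteq> k0" using 2(1) by blast
      then obtain j where j: "k = Suc j" "k0 \<le> j" using k(1) by (cases k) auto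
      have "\<not> Q j" using not_less_Least[of j "\<lambda>k. k0 \<le> k \<and> Q k"] j unfolding k_def[symmetric] by simp
      then have "measure \<mu> {x..<y} \<le> lo k powr s" using nQ[of j] k0[OF j(2)] j(1) by simp
      then show ?thesis using Qs[OF k(2)] C1 by linarith
    next
      case 3
      have "(\<lambda>k. 2 * hi k) \<longlonglongrightarrow> 2 * 0" by (intro tendsto_mult tendsto_const hi_lim)
      moreover have "\<forall>k\<ge>k0. measure \<mu> {x..<y} \<le> 2 * hi k" using nQ 3 by blast
      ultimately have "measure \<mu> {x..<y} \<le> 2 * 0" by (meson LIMSEQ_le_const)
      moreover have "0 \<le> C * measure \<nu> {x..<y} powr s" by (simp add: C_def)
      ultimately show ?thesis by linarith
    qed
  qed
  moreover have "1 \<le> C" by (simp add: C_def)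
  ultimately show ?thesis by blast
qed

text \<open>A point of \<open>{0..<1}\<close> lies in a floor of every level, and floors have
  measure at most \<open>hi k\<close>, which tends to 0. Points outside are null because
  \<open>{0..<1}\<close> has full measure.\<close>

lemma measure_point:
  assumes \<mu>: "\<mu> \<in> Ms"
  shows "measure \<mu> {x} = 0"
proof -
  interpret prob_space \<mu> using Ms \<mu> by blast
  have sb: "sets \<mu> = sets borel" "measure \<mu> {0..<1} = 1" using Ms[OF \<mu>] by (auto simp: measure_def)
  show ?thesis
  proof (cases "x \<in> {0..<1}")
    case True
    have "measure \<mu> {x} \<le> hi k" for k
    proof -
      obtain F where F: "floor_family Ms (top_row n) (lk k) F" using floors by blast
      then have "{0..<1} \<subseteq> (\<Union>(z, w)\<in>F. {w..<w + lk k z})" unfolding floor_family_def by blast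
      then obtain z w where zw: "(z, w) \<in> F" "x \<in> {w..<w + lk k z}" using True by blast
      have "measure \<mu> {x} \<le> measure \<mu> {w..<w + lk k z}"
        using zw sb by (intro finite_measure_mono) auto
      also have "\<dots> = Lm \<mu> k z" using floor_measure(1)[OF F \<mu> zw(1) lk_pos] by (simp add: Lm_def)
      also have "\<dots> \<le> hi k"
        using floor_measure(2)[OF F \<mu> zw(1) lk_pos] rows(1)[OF n_even n_ge] by (intro Lm_bounds(2)[OF \<mu>]) simp
      finally show ?thesis .
    qed
    then have "measure \<mu> {x} \<le> 0" using hi_lim by (meson LIMSEQ_le_const)
    then show ?thesis by (simp add: measure_le_0_iff)
  next
    case False
    have "measure \<mu> ({x} \<union> {0..<1}) = measure \<mu> {x} + measure \<mu> {0..<1}"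
      using False sb by (intro finite_measure_Union) auto
    moreover have "measure \<mu> ({x} \<union> {0..<1}) \<le> 1" by simp
    ultimately have "measure \<mu> {x} \<le> 0" using sb by linarith
    then show ?thesis by (simp add: measure_le_0_iff)
  qed
qed

section \<open>The two lower limits and the dimension\<close>

lemma ln_bounds:
  assumes "\<mu> \<in> Ms" "i \<in> {1..n}"
  shows "- ln (Lm \<mu> k i) \<le> lfun k" "hfun k \<le> - ln (Lm \<mu> k i)"
proof -
  note b = Lm_bounds[OF assms, of k]
  have "0 < Lm \<mu> k i" using b(1) lo_pos[of k] by linarith
  then have "ln (lo k) \<le> ln (Lm \<mu> k i)" "ln (Lm \<mu> k i) \<le> ln (hi k)" using b lo_pos[of k] by simp_all
  then show "- ln (Lm \<mu> k i) \<le> lfun k" "hfun k \<le> - ln (Lm \<mu> k i)" unfolding ln_lo ln_hi by linarith+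
qed

text \<open>Minus the logarithms of both measures eventually lie between the positive
  \<open>hfun k\<close> and \<open>lfun k\<close>, whose quotient tends to 1.\<close>

lemma liminf_left:
  assumes \<mu>: "\<mu> \<in> Ms" and \<nu>: "\<nu> \<in> Ms" and i: "i \<in> {1..n}"
  shows "liminf (\<lambda>k. ereal (log (Lm \<nu> k i) (Lm \<mu> k i))) \<le> 1"
proof -
  have "eventually (\<lambda>k. 0 < hfun k) sequentially"
    using hfun_at_top by (simp add: filterlim_at_top_dense)
  then have "eventually (\<lambda>k. ereal (log (Lm \<nu> k i) (Lm \<mu> k i)) \<le> ereal (lfun k / hfun k)) sequentially"
  proof eventually_elim
    case (elim k)
    have "log (Lm \<nu> k i) (Lm \<mu> k i) = - ln (Lm \<mu> k i) / - ln (Lm \<nu> k i)" by (simp add: log_def)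
    also have "\<dots> \<le> lfun k / hfun k"
      using ln_bounds(1)[OF \<mu> i] ln_bounds(2)[OF \<nu> i] elim lfun_nonneg by (intro frac_le)
    finally show ?case by simp
  qed
  then have "liminf (\<lambda>k. ereal (log (Lm \<nu> k i) (Lm \<mu> k i))) \<le> liminf (\<lambda>k. ereal (lfun k / hfun k))"
    by (rule Liminf_mono)
  also have "\<dots> = ereal 1" using lfun_hfun by (intro lim_imp_Liminf) auto
  finally show ?thesis by (simp add: one_ereal_def)
qed

text \<open>\<open>bki_ge\<close> bounds the numerator ln b below by \<open>?w k\<close>, and
  \<open>lfun k\<close> bounds the denominator above. Both grow like k^2 ln p.\<close>

lemma liminf_right:
  assumes \<nu>: "\<nu> \<in> Ms" and i: "i \<in> {1..n}" "i \<in> special_idx n"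
  shows "1 \<le> liminf (\<lambda>k. ereal (log (Lm \<nu> k i) (1 / bki n a c k i)))"
proof -
  let ?w = "\<lambda>k. ((real k)\<^sup>2 - real k) * ln (real p)"
  have "eventually (\<lambda>k. 0 < hfun k) sequentially"
    using hfun_at_top by (simp add: filterlim_at_top_dense)
  then have "eventually (\<lambda>k. ereal (?w k / lfun k) \<le> ereal (log (Lm \<nu> k i) (1 / bki n a c k i))) sequentially"
    using eventually_ge_at_top[of 1]
  proof eventually_elim
    case (elim k)
    let ?b = "bki n a c k i"
    have pk: "0 < real p ^ m" for m using p_gt by simp
    have bp: "0 < ?b * real p ^ k" using bki_ge[OF i(2), of k] pk[of "k\<^sup>2"] by linarith
    with pk[of k] have b: "0 < ?b" by (simp add: zero_less_mult_iff)
    have "ln (real p ^ (k\<^sup>2)) \<le> ln (?b * real p ^ k)"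
      using ln_le_cancel_iff[OF pk bp, of "k\<^sup>2"] bki_ge[OF i(2), of k] by blast
    also have "\<dots> = ln ?b + ln (real p ^ k)" using b pk[of k] by (simp add: ln_mult)
    finally have w: "?w k \<le> ln ?b" using p_gt by (simp add: ln_realpow algebra_simps)
    \<comment> \<open>Comparing the quotients needs a nonnegative numerator, whence the restriction
      to k \<ge> 1.\<close>
    have "real k \<le> (real k)\<^sup>2" using elim(2) by (simp add: power2_eq_square)
    then have "0 \<le> ?w k" using lnp by simp
    then have b0: "0 \<le> ln ?b" using w by linarith
    have "?w k / lfun k \<le> ln ?b / - ln (Lm \<nu> k i)"
      using w b0 ln_bounds[OF \<nu> i(1), of k] elim by (intro frac_le) auto
    also have "\<dots> = log (Lm \<nu> k i) (1 / ?b)" using b by (simp add: log_def ln_div)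
    finally show ?case by simp
  qed
  then have "liminf (\<lambda>k. ereal (?w k / lfun k)) \<le> liminf (\<lambda>k. ereal (log (Lm \<nu> k i) (1 / bki n a c k i)))"
    by (rule Liminf_mono)
  moreover have "(\<lambda>k. ?w k / lfun k) \<longlonglongrightarrow> 1"
    unfolding lfun_def by (rule quadratic_asymptotics(3)[OF lnp])
  then have "liminf (\<lambda>k. ereal (?w k / lfun k)) = ereal 1" by (intro lim_imp_Liminf) auto
  ultimately show ?thesis by (simp add: one_ereal_def)
qed

lemma dimH_measure_eq_1:
  assumes \<mu>: "\<mu> \<in> Ms" and \<nu>: "\<nu> \<in> Ms"
  shows "dimH_measure \<mu> (d_nu \<nu>) = 1"
proof (rule antisym)
  show "dimH_measure \<mu> (d_nu \<nu>) \<le> 1" using Ms[OF \<mu>] Ms[OF \<nu>] by (intro dimH_measure_le_1) auto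
  show "1 \<le> dimH_measure \<mu> (d_nu \<nu>)"
    using Ms[OF \<mu>] Ms[OF \<nu>] measure_point[OF \<mu>] interval_measure_powr[OF \<mu> \<nu>]
    by (intro dimH_measure_ge_1) blast+
qed

end

theorem theorem2:
  fixes n p c1 :: nat and a c :: "nat \<Rightarrow> nat" and l :: "nat \<Rightarrow> real"
    and Mi Mj :: "real measure" and i j :: nat
  assumes "even n" and "n \<ge> 4" and "p \<ge> n + 1" and "c1 > 0"
    and "c 1 = c1" and "\<forall>k\<ge>1. c (Suc k) = p\<^sup>2 * c k" and "\<forall>k\<ge>1. a k = p * c k"
    and "\<forall>r\<in>{1..n}. l r > 0" and "(\<Sum>r=1..n. l r) = 1"
    and "has_rauzy_path n a c l"
    and "i \<in> special_idx n" and "j \<in> special_idx n" and "i \<noteq> j"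
    and "is_lambda n a c l i Mi" and "is_lambda n a c l j Mj"
  shows "liminf (\<lambda>k. ereal (log (measure Mj (Ik n a c l k i)) (measure Mi (Ik n a c l k i))))
           \<le> dimH_measure Mi (d_nu Mj)
       \<and> dimH_measure Mi (d_nu Mj)
           \<le> liminf (\<lambda>k. ereal (log (measure Mj (Ik n a c l k i)) (1 / bki n a c k i)))"
proof -
  \<comment> \<open>Both measures go into one set, so that they share the floors of every
    level.\<close>
  interpret iet_setup n p a c l "{Mi, Mj}"
  proof
    fix M assume "M \<in> {Mi, Mj}"
    then show "sets M = sets borel \<and> prob_space M \<and> emeasure M {0..<1} = 1 \<and>
       distr M borel (iet_map (top_row n) (bot_row n) l) = M"
      using assms(14,15) unfolding is_lambda_def by blast
  qed (use assms in auto)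
  have i: "i \<in> {1..n}" using assms(2,11) by (auto simp: special_idx_def)
  have "Mi \<in> {Mi, Mj}" "Mj \<in> {Mi, Mj}" by simp_all
  then show ?thesis
    using liminf_left[of Mi Mj i] liminf_right[of Mj i] dimH_measure_eq_1[of Mi Mj] i assms(11)
    by (simp only: Ik_eq[OF i] simp_thms)
qed

end
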